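(* Let $\rho,\delta\in(0,1)$ and consider a sequence of triples of integers $(k_n,n,N_n)$, indexed by $n$, with $k_n<n<N_n$, $k_n/n\to\rho$ and $n/N_n\to\delta$ as $n\to\infty$. Write $k=k_n$, $N=N_n$. For each $n$ let $A$ be a random $n\times N$ matrix whose nullspace is an orthant-symmetric and generic random subspace. Let $\mathbb{R}_+^N$ be the positive orthant and $\rho_W(\delta;\mathbb{R}_+^N):=\max(0,2-\delta^{-1})$. Then $$\lim_{n\to\infty}\frac{\mathcal{E}f_k(A\mathbb{R}_+^N)}{f_k(\mathbb{R}_+^N)}=\begin{cases}1,&\rho<\rho_W(\delta;\mathbb{R}_+^N),\\ 0,&\rho>\rho_W(\delta;\mathbb{R}_+^N).\end{cases}$$
   Context: $\mathbb{R}_+^N=\{x\in\mathbb{R}^N: x_i\ge 0\ \forall i\}$. For a polyhedron $Q$, $f_k(Q)$ denotes the number of $k$-dimensional faces of $Q$; $AQ$ is the image of $Q$ under $A$; $\mathcal{E}$ denotes expectation. A random $(N-n)\times N$ matrix $B$ is orthant-symmetric if for each diagonal matrix $S$ with diagonal in $\{-1,1\}^N$ and every measurable set $\Omega$, $\mathrm{Prob}\{BS\in\Omega\}=\mathrm{Prob}\{B\in\Omega\}$. Let $V_B$ be the linear span of the rows of $B$. If $B$ is orthant-symmetric, $V_B$ is called an orthant-symmetric random subspace. If every subset of $N-n$ columns of $B$ is almost surely linearly independent, $V_B$ is called a generic random subspace. A random $n\times N$ matrix $A$ has an orthant-symmetric and generic nullspace if its nullspace $\mathcal{N}(A)$ equals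 $V_B$ for a random matrix $B$ having both properties. *)

theory Defs
  imports "HOL-Probability.Probability" "HOL-Analysis.Finite_Function_Topology"
begin

text \<open>
  The dimensions n and N vary along the sequence, so they cannot be types.  All the spaces
  \<open>\<real>\<^sup>N\<close> live inside the one real vector space \<^typ>\<open>nat \<Rightarrow>\<^sub>0 real\<close> of finitely supported sequences, as the
  sets of vectors supported on the coordinates \<open>{..<N}\<close>.  Coordinates are numbered from 0.
\<close>

type_synonym point = "nat \<Rightarrow>\<^sub>0 real"

definition euclid :: "nat \<Rightarrow> point set" where
  "euclid N = {x. Poly_Mapping.keys x \<subseteq> {..<N}}"

definition vec_of :: "nat \<Rightarrow> (nat \<Rightarrow> real) \<Rightarrow> point" where
  "vec_of p f = (\<Sum>i<p. Poly_Mapping.single i (f i))"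

definition orthant :: "nat \<Rightarrow> point set" where
  "orthant N = {x \<in> euclid N. \<forall>i<N. 0 \<le> Poly_Mapping.lookup x i}"

text \<open>
  A \<open>p \<times> q\<close> matrix is a function on index pairs of which only the values on
  \<open>{..<p} \<times> {..<q}\<close> matter; the measurable sets of matrices are the Borel sets of \<open>\<real>\<^sup>p\<^sup>q\<close>.
\<close>

type_synonym matrix = "nat \<times> nat \<Rightarrow> real"

definition matrix_space :: "nat \<Rightarrow> nat \<Rightarrow> matrix measure" where
  "matrix_space p q = Pi\<^sub>M ({..<p} \<times> {..<q}) (\<lambda>_. borel)"

definition random_matrix :: "'a measure \<Rightarrow> nat \<Rightarrow> nat \<Rightarrow> ('a \<Rightarrow> matrix) \<Rightarrow> bool" where
  "random_matrix M p q A \<longleftrightarrow> A \<in> measurable M (matrix_space p q)"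

definition mat_vec :: "nat \<Rightarrow> nat \<Rightarrow> matrix \<Rightarrow> point \<Rightarrow> point" where
  "mat_vec p q A x = vec_of p (\<lambda>i. \<Sum>j<q. A (i, j) * Poly_Mapping.lookup x j)"

definition mat_mult :: "nat \<Rightarrow> nat \<Rightarrow> nat \<Rightarrow> matrix \<Rightarrow> matrix \<Rightarrow> matrix" where
  "mat_mult p q r A B =
     restrict (\<lambda>(i, j). \<Sum>l<q. A (i, l) * B (l, j)) ({..<p} \<times> {..<r})"

definition mat_row :: "nat \<Rightarrow> matrix \<Rightarrow> nat \<Rightarrow> point" where
  "mat_row q A i = vec_of q (\<lambda>j. A (i, j))"

definition mat_col :: "nat \<Rightarrow> matrix \<Rightarrow> nat \<Rightarrow> point" where
  "mat_col p A j = vec_of p (\<lambda>i. A (i, j))"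

definition row_space :: "nat \<Rightarrow> nat \<Rightarrow> matrix \<Rightarrow> point set" where
  "row_space p q B = span (mat_row q B ` {..<p})"

definition nullspace :: "nat \<Rightarrow> nat \<Rightarrow> matrix \<Rightarrow> point set" where
  "nullspace p q A = {x \<in> euclid q. mat_vec p q A x = 0}"

definition sign_diagonal :: "nat \<Rightarrow> matrix \<Rightarrow> bool" where
  "sign_diagonal N S \<longleftrightarrow>
     (\<forall>i<N. \<forall>j<N. i \<noteq> j \<longrightarrow> S (i, j) = 0) \<and> (\<forall>i<N. S (i, i) \<in> {-1, 1})"

definition orthant_symmetric :: "'a measure \<Rightarrow> nat \<Rightarrow> nat \<Rightarrow> ('a \<Rightarrow> matrix) \<Rightarrow> bool" where
  "orthant_symmetric M m N B \<longleftrightarrow>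
     (\<forall>S. sign_diagonal N S \<longrightarrow>
       (\<forall>\<Omega> \<in> sets (matrix_space m N).
          measure M {\<omega> \<in> space M. mat_mult m N N (B \<omega>) S \<in> \<Omega>} =
          measure M {\<omega> \<in> space M. B \<omega> \<in> \<Omega>}))"

text \<open>
  Linear independence is that of the columns as an indexed family: a repeated column counts as a
  dependence, whence the injectivity.
\<close>

definition generic :: "'a measure \<Rightarrow> nat \<Rightarrow> nat \<Rightarrow> ('a \<Rightarrow> matrix) \<Rightarrow> bool" where
  "generic M m N B \<longleftrightarrow>
     (\<forall>J. J \<subseteq> {..<N} \<and> card J = m \<longrightarrow>
       (AE \<omega> in M. inj_on (mat_col m (B \<omega>)) J \<and> independent (mat_col m (B \<omega>) ` J)))"

text \<open>
  Random subspaces are identified when they agree almost surely, so the nullspace has to equal the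
  row space of B only outside a null set.
\<close>

definition orthant_symmetric_generic_nullspace ::
  "'a measure \<Rightarrow> nat \<Rightarrow> nat \<Rightarrow> ('a \<Rightarrow> matrix) \<Rightarrow> bool" where
  "orthant_symmetric_generic_nullspace M n N A \<longleftrightarrow>
     (\<exists>B. random_matrix M (N - n) N B \<and>
          orthant_symmetric M (N - n) N B \<and>
          generic M (N - n) N B \<and>
          (AE \<omega> in M. nullspace n N (A \<omega>) = row_space (N - n) N (B \<omega>)))"

text \<open>
  The library's \<^const>\<open>aff_dim\<close> is confined to Euclidean spaces, which \<^typ>\<open>point\<close> is not;
  the following is the property by which it is defined.
\<close>

definition has_aff_dim :: "point set \<Rightarrow> nat \<Rightarrow> bool" where
  "has_aff_dim F d \<longleftrightarrow>
     (\<exists>B. affine hull B = affine hull F \<and> \<not> affine_dependent B \<and> card B = d + 1)"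

definition num_faces :: "nat \<Rightarrow> point set \<Rightarrow> nat" where
  "num_faces k Q = card {F. F face_of Q \<and> has_aff_dim F k}"

text \<open>
  The number of faces is a nonnegative random variable; its expectation is taken as the
  Lebesgue integral with values in \<^typ>\<open>ennreal\<close>, which involves no integrability convention.
\<close>

definition expected_num_faces ::
  "'a measure \<Rightarrow> nat \<Rightarrow> nat \<Rightarrow> nat \<Rightarrow> ('a \<Rightarrow> matrix) \<Rightarrow> point set \<Rightarrow> ennreal" where
  "expected_num_faces M k n N A Q =
     (\<integral>\<^sup>+ \<omega>. of_nat (num_faces k (mat_vec n N (A \<omega>) ` Q)) \<partial>M)"

definition rho_W_orthant :: "real \<Rightarrow> real" where
  "rho_W_orthant \<delta> = max 0 (2 - 1 / \<delta>)"

end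

theory Submission
  imports Defs
begin

text \<open>
  Let \<open>m = N - n\<close>, \<open>M = N - k\<close>, and let \<open>B\<close> be the matrix whose rows span the nullspace of \<open>A\<close>.  The
  face of the orthant with support \<open>I\<close>, \<open>|I| = k\<close>, survives the projection iff no vector of the row
  space of \<open>B\<close> is nonnegative and nonzero off \<open>I\<close>; by general position this is the same as no vector
  being strictly positive off \<open>I\<close>.  By orthant symmetry all \<open>2\<^sup>M\<close> sign patterns off \<open>I\<close> are equally
  likely to be realised by the row space, so the probability of losing the face is the expected
  number of realised patterns divided by \<open>2\<^sup>M\<close>.  Deletion and restriction of a coordinate bound
  that number between the sums of the binomial coefficients \<open>M choose l\<close> over \<open>l < m\<close> and over
  \<open>l \<le> m\<close> (Wendel).  Hence the limit is decided by whether \<open>m / M\<close>, which tends to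
  \<open>(1 - \<delta>) / (1 - \<rho> \<delta>)\<close>, stays below or above \<open>1/2\<close>, by Chebyshev's inequality for the symmetric
  binomial distribution.
\<close>

section \<open>Sign patterns of a subspace in general position\<close>

text \<open>A linear subspace of plain real functions. Nonemptiness with two-term combinations
  already yields the zero vector, and the notion passes to the hyperplane sections on which the
  inductions run.\<close>

definition lin_closed :: "('b \<Rightarrow> real) set \<Rightarrow> bool" where
  "lin_closed V \<longleftrightarrow> V \<noteq> {} \<and> (\<forall>u\<in>V. \<forall>v\<in>V. \<forall>a b. (\<lambda>i. a * u i + b * v i) \<in> V)"

text \<open>A strict sign pattern is coded by its set of positive coordinates. A vector with a zero
  in \<open>X\<close> realises nothing, so this lists the open orthants in the coordinates
  \<open>X\<close> that \<open>V\<close> meets.\<close>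

definition sign_patterns :: "('b \<Rightarrow> real) set \<Rightarrow> 'b set \<Rightarrow> 'b set set" where
  "sign_patterns V X = {T. T \<subseteq> X \<and> (\<exists>v\<in>V. (\<forall>i\<in>T. 0 < v i) \<and> (\<forall>i\<in>X - T. v i < 0))}"

lemma sign_patternsI:
  assumes "T \<subseteq> X" "v \<in> V" "\<And>i. i \<in> T \<Longrightarrow> 0 < v i" "\<And>i. i \<in> X \<Longrightarrow> i \<notin> T \<Longrightarrow> v i < 0"
  shows "T \<in> sign_patterns V X"
  using assms unfolding sign_patterns_def by auto

lemma lin_closedD:
  assumes "lin_closed V" "u \<in> V" "v \<in> V"
  shows "(\<lambda>i. a * u i + b * v i) \<in> V"
  using assms unfolding lin_closed_def by blast

lemma lin_closed_hyperplane:
  assumes "lin_closed V"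
  shows "lin_closed {v \<in> V. v x = 0}"
proof -
  obtain u where "u \<in> V" using assms unfolding lin_closed_def by blast
  then have "(\<lambda>i. 0 * u i + 0 * u i) \<in> V" using lin_closedD[OF assms] by blast
  then have "{v \<in> V. v x = 0} \<noteq> {}" by auto
  then show ?thesis using lin_closedD[OF assms] unfolding lin_closed_def by auto
qed

lemma finite_sign_patterns: "finite X \<Longrightarrow> finite (sign_patterns V X)"
  by (rule finite_subset[of _ "Pow X"]) (auto simp: sign_patterns_def)

text \<open>
  In general position \<open>A \<union> B\<close> are the patterns on \<open>X\<close> of \<open>V\<close> itself, and \<open>A \<inter> B\<close> those of its hyperplane
  section \<open>v x = 0\<close>; this is Pascal's recursion for the number of patterns.
\<close>

lemma card_sign_patterns_insert:
  fixes V :: "('b \<Rightarrow> real) set"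
  assumes "finite X" "x \<notin> X"
  defines "A \<equiv> {T \<in> Pow X. T \<in> sign_patterns V (insert x X)}"
    and "B \<equiv> {T \<in> Pow X. insert x T \<in> sign_patterns V (insert x X)}"
  shows "card (sign_patterns V (insert x X)) = card (A \<union> B) + card (A \<inter> B)"
proof -
  have fin: "finite A" "finite B" using assms by auto
  have "T \<in> A \<union> insert x ` B" if T: "T \<in> sign_patterns V (insert x X)" for T
  proof (cases "x \<in> T")
    case True
    have "T \<subseteq> insert x X" using T unfolding sign_patterns_def by blast
    then have "T - {x} \<in> B" "insert x (T - {x}) = T"
      using T True by (auto simp: B_def insert_absorb)
    then show ?thesis by (metis UnI2 image_eqI)
  next
    case False
    have "T \<subseteq> insert x X" using T unfolding sign_patterns_def by blast
    then show ?thesis using T False unfolding A_def by blast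
  qed
  then have eq: "sign_patterns V (insert x X) = A \<union> insert x ` B"
    unfolding A_def B_def by blast
  have "inj_on (insert x) B"
    using assms(2) unfolding B_def inj_on_def by (metis (no_types, lifting) Diff_insert_absorb PowD mem_Collect_eq subsetD)
  moreover have "A \<inter> insert x ` B = {}" using assms(2) unfolding A_def by blast
  ultimately have "card (sign_patterns V (insert x X)) = card A + card B"
    unfolding eq using fin by (simp add: card_Un_disjoint card_image)
  then show ?thesis using card_Un_Int[OF fin] by simp
qed

text \<open>Pascal's rule summed over an initial segment, to match the recursion for
  patterns.\<close>

lemma sum_choose_Suc:
  "(\<Sum>l\<le>Suc m. Suc M choose l) = (\<Sum>l\<le>Suc m. M choose l) + (\<Sum>l\<le>m. M choose l)"
proof -
  have "(\<Sum>l\<le>Suc m. Suc M choose l) = 1 + (\<Sum>l\<le>m. Suc M choose Suc l)"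
    by (subst sum.atMost_Suc_shift) simp
  also have "\<dots> = (1 + (\<Sum>l\<le>m. M choose Suc l)) + (\<Sum>l\<le>m. M choose l)"
    by (simp add: sum.distrib)
  also have "1 + (\<Sum>l\<le>m. M choose Suc l) = (\<Sum>l\<le>Suc m. M choose l)"
    by (subst sum.atMost_Suc_shift) simp
  finally show ?thesis .
qed

text \<open>The third assumption is the half of general position that limits zeros. When
  \<open>x\<close> is removed, \<open>A \<union> B\<close> consists of patterns of \<open>V\<close>
  on \<open>X\<close>, and \<open>A \<inter> B\<close> of patterns of the section
  \<open>v x = 0\<close>, for which \<open>m\<close> drops by one; the summed Pascal rule closes the
  induction.\<close>

lemma card_sign_patterns_le:
  assumes "finite X" "lin_closed V"
    and "\<And>J v. J \<subseteq> X \<Longrightarrow> card J = m \<Longrightarrow> v \<in> V \<Longrightarrow> (\<And>i. i \<in> J \<Longrightarrow> v i = 0) \<Longrightarrow> (\<forall>i\<in>X. v i = 0)"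
  shows "card (sign_patterns V X) \<le> (\<Sum>l\<le>m. card X choose l)"
  using assms
proof (induction X arbitrary: V m rule: finite_induct)
  case empty
  have "sign_patterns V {} \<subseteq> {{}}" by (auto simp: sign_patterns_def)
  then have "card (sign_patterns V {}) \<le> 1"
    by (metis card.empty card_insert_disjoint card_mono finite.emptyI finite.insertI insert_absorb
        insert_not_empty One_nat_def)
  also have "1 \<le> (\<Sum>l\<le>m. 0 choose l)"
    by (subst sum.atMost_shift) simp
  finally show ?case by simp
next
  case (insert x X)
  show ?case
  proof (cases m)
    case 0
    \<comment> \<open>With \<open>m = 0\<close> the empty \<open>J\<close> already forces every
      vector to vanish everywhere, so no strict pattern exists.\<close>
    have vx: "v x = 0" if "v \<in> V" for v
      using insert.prems(2)[of "{}" v] that 0 by auto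
    have "T \<notin> sign_patterns V (insert x X)" for T
    proof
      assume "T \<in> sign_patterns V (insert x X)"
      then obtain v where "v \<in> V" "\<forall>i\<in>T. 0 < v i" "\<forall>i\<in>insert x X - T. v i < 0"
        unfolding sign_patterns_def by blast
      moreover from this have "0 < v x \<or> v x < 0" by (cases "x \<in> T") blast+
      ultimately show False using vx[of v] by simp
    qed
    then have "sign_patterns V (insert x X) = {}" by blast
    then show ?thesis by simp
  next
    case (Suc m')
    define W where "W = {v \<in> V. v x = 0}"
    define A where "A = {T \<in> Pow X. T \<in> sign_patterns V (insert x X)}"
    define B where "B = {T \<in> Pow X. insert x T \<in> sign_patterns V (insert x X)}"
    have "A \<union> B \<subseteq> sign_patterns V X"
      using insert.hyps(2) unfolding A_def B_def sign_patterns_def by blast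
    then have "card (A \<union> B) \<le> card (sign_patterns V X)"
      by (rule card_mono[OF finite_sign_patterns[OF insert.hyps(1)]])
    also have "\<dots> \<le> (\<Sum>l\<le>Suc m'. card X choose l)"
    proof (rule insert.IH[OF insert.prems(1)])
      fix J v assume "J \<subseteq> X" "card J = Suc m'" "v \<in> V" "\<And>i. i \<in> J \<Longrightarrow> v i = 0"
      then show "\<forall>i\<in>X. v i = 0"
        using insert.prems(2)[of J v] Suc by auto
    qed
    finally have 1: "card (A \<union> B) \<le> (\<Sum>l\<le>Suc m'. card X choose l)" .
    have "A \<inter> B \<subseteq> sign_patterns W X"
    proof
      fix T assume T: "T \<in> A \<inter> B"
      then have TX: "T \<subseteq> X" by (auto simp: A_def)
      obtain u where u: "u \<in> V" "\<forall>i\<in>T. 0 < u i" "\<forall>i\<in>insert x X - T. u i < 0"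
        using T by (auto simp: A_def sign_patterns_def)
      obtain v where v: "v \<in> V" "\<forall>i\<in>insert x T. 0 < v i" "\<forall>i\<in>insert x X - insert x T. v i < 0"
        using T by (auto simp: B_def sign_patterns_def)
      have ux: "u x < 0" using u(3) TX insert.hyps(2) by auto
      have vx: "v x > 0" using v by auto
      \<comment> \<open>The positive combination of \<open>u\<close> and \<open>v\<close> that
        cancels coordinate \<open>x\<close>; where \<open>u\<close> and \<open>v\<close> agree in
        sign on \<open>X\<close>, that sign survives.\<close>
      let ?w = "\<lambda>i. v x * u i + (- u x) * v i"
      have "?w \<in> W" using lin_closedD[OF insert.prems(1) u(1) v(1), of "v x" "- u x"]
        by (simp add: W_def)
      moreover have "0 < ?w i" if "i \<in> T" for i
      proof -
        have "0 < u i" "0 < v i" using that u v by auto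
        then have "0 < v x * u i" "0 < (- u x) * v i"
          using ux vx by (auto simp: mult_neg_pos)
        then show ?thesis by linarith
      qed
      moreover have "?w i < 0" if "i \<in> X - T" for i
      proof -
        have "u i < 0" "v i < 0" using that u v insert.hyps(2) by auto
        then have "v x * u i < 0" "(- u x) * v i < 0"
          using ux vx by (auto simp: mult_pos_neg mult_neg_neg)
        then show ?thesis by linarith
      qed
      ultimately show "T \<in> sign_patterns W X"
        using TX by (intro sign_patternsI[of T X ?w]) auto
    qed
    then have "card (A \<inter> B) \<le> card (sign_patterns W X)"
      by (rule card_mono[OF finite_sign_patterns[OF insert.hyps(1)]])
    also have "\<dots> \<le> (\<Sum>l\<le>m'. card X choose l)"
    proof (rule insert.IH)
      show "lin_closed W" unfolding W_def by (rule lin_closed_hyperplane[OF insert.prems(1)])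
      fix J v assume J: "J \<subseteq> X" "card J = m'" "v \<in> W" "\<And>i. i \<in> J \<Longrightarrow> v i = 0"
      \<comment> \<open>Members of \<open>W\<close> also vanish at \<open>x\<close>, so
        \<open>m'\<close> zeros in \<open>X\<close> amount to \<open>m\<close> zeros in
        \<open>insert x X\<close>.\<close>
      have "finite J" "x \<notin> J" using J insert.hyps by (auto intro: finite_subset)
      then have "card (insert x J) = m" using J Suc by simp
      then show "\<forall>i\<in>X. v i = 0"
        using insert.prems(2)[of "insert x J" v] J unfolding W_def by auto
    qed
    finally have 2: "card (A \<inter> B) \<le> (\<Sum>l\<le>m'. card X choose l)" .
    have "card (sign_patterns V (insert x X)) = card (A \<union> B) + card (A \<inter> B)"
      unfolding A_def B_def by (rule card_sign_patterns_insert[OF insert.hyps])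
    then show ?thesis
      using 1 2 insert.hyps unfolding Suc by (simp add: sum_choose_Suc del: sum.atMost_Suc)
  qed
qed

text \<open>Finitely many strict inequalities, each stable for small \<open>e\<close>, hold together
  for some positive \<open>e\<close>.\<close>

lemma positive_perturbation:
  fixes v u :: "'b \<Rightarrow> real"
  assumes "finite X" "\<And>i. i \<in> X \<Longrightarrow> 0 < v i"
  shows "\<exists>e>0. \<forall>i\<in>X. 0 < v i + e * u i"
proof -
  have "\<forall>\<^sub>F e in at_right 0. 0 < v i + e * u i" if "i \<in> X" for i
  proof -
    have "((\<lambda>e. v i + e * u i) \<longlongrightarrow> v i + 0 * u i) (at_right 0)"
      by (intro tendsto_intros)
    then show ?thesis using assms(2)[OF that] by (auto intro: order_tendstoD)
  qed
  then have "\<forall>\<^sub>F e in at_right 0. \<forall>i\<in>X. 0 < v i + e * u i"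
    using assms(1) by (simp add: eventually_ball_finite)
  moreover have "\<forall>\<^sub>F e in at_right (0::real). 0 < e"
    by (simp add: eventually_at_right_less)
  ultimately have "\<forall>\<^sub>F e in at_right 0. 0 < e \<and> (\<forall>i\<in>X. 0 < v i + e * u i)"
    by eventually_elim auto
  then show ?thesis
    using eventually_happens[of _ "at_right (0::real)"] by fastforce
qed

text \<open>A vector vanishing at \<open>x\<close> can be tilted slightly along \<open>u\<close> or
  against it. This leaves the signs on \<open>X\<close> alone and gives coordinate \<open>x\<close>
  either sign.\<close>

lemma sign_patterns_insert_zero:
  assumes "finite X" "x \<notin> X" "lin_closed V" "u \<in> V" "u x \<noteq> 0" "T \<subseteq> X"
    and v: "v \<in> V" "v x = 0" "\<forall>i\<in>T. 0 < v i" "\<forall>i\<in>X - T. v i < 0"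
  shows "T \<in> sign_patterns V (insert x X)" "insert x T \<in> sign_patterns V (insert x X)"
proof -
  \<comment> \<open>Multiplying by the pattern turns the mixed inequalities into positivity, so one
    perturbation handles both signs.\<close>
  define s where "s i = (if i \<in> T then 1 else - 1 :: real)" for i
  have sv: "0 < s i * v i" if "i \<in> X" for i using v that by (auto simp: s_def)
  have *: "\<exists>e>0. (\<forall>i\<in>T. 0 < v i + e * (c * u i)) \<and> (\<forall>i\<in>X - T. v i + e * (c * u i) < 0)" for c
  proof -
    obtain e where "e > 0" and e: "\<forall>i\<in>X. 0 < s i * v i + e * (s i * (c * u i))"
      using positive_perturbation[OF assms(1), of "\<lambda>i. s i * v i" "\<lambda>i. s i * (c * u i)"] sv
      by auto
    have "(\<forall>i\<in>T. 0 < v i + e * (c * u i)) \<and> (\<forall>i\<in>X - T. v i + e * (c * u i) < 0)"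
    proof (intro conjI ballI)
      fix i assume i: "i \<in> T"
      then have "i \<in> X" using assms(6) by blast
      then show "0 < v i + e * (c * u i)" using e i by (auto simp: s_def)
    next
      fix i assume "i \<in> X - T"
      then show "v i + e * (c * u i) < 0" using e by (auto simp: s_def)
    qed
    then show ?thesis using \<open>e > 0\<close> by blast
  qed
  have mem: "(\<lambda>i. v i + e * (c * u i)) \<in> V" for e c
    using lin_closedD[OF assms(3) v(1) assms(4), of 1 "e * c"] by (simp add: mult.assoc)
  have sq: "0 < u x * u x" using assms(5) by (metis not_real_square_gt_zero)
  \<comment> \<open>Scaling the tilt by \<open>u x\<close> makes its value at \<open>x\<close> the
    square of \<open>u x\<close>, whatever the sign of \<open>u x\<close>; scaling by
    \<open>- u x\<close> below gives the negative.\<close>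
  obtain e where e: "e > 0" "\<forall>i\<in>T. 0 < v i + e * (u x * u i)" "\<forall>i\<in>X - T. v i + e * (u x * u i) < 0"
    using *[of "u x"] by blast
  have "0 < v x + e * (u x * u x)" using e(1) sq v(2) by simp
  then have "(\<forall>i\<in>insert x T. 0 < v i + e * (u x * u i)) \<and> (\<forall>i\<in>insert x X - insert x T. v i + e * (u x * u i) < 0)"
    using e by auto
  then show "insert x T \<in> sign_patterns V (insert x X)"
    using mem[of e "u x"] assms(6)
    by (intro sign_patternsI[where v = "\<lambda>i. v i + e * (u x * u i)"]) auto
  obtain e where e: "e > 0" "\<forall>i\<in>T. 0 < v i + e * (- u x * u i)" "\<forall>i\<in>X - T. v i + e * (- u x * u i) < 0"
    using *[of "- u x"] by blast
  have "v x + e * (- u x * u x) < 0" using e(1) sq v(2) by simp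
  then have "(\<forall>i\<in>T. 0 < v i + e * (- u x * u i)) \<and> (\<forall>i\<in>insert x X - T. v i + e * (- u x * u i) < 0)"
    using e by auto
  then show "T \<in> sign_patterns V (insert x X)"
    using mem[of e "- u x"] assms(6)
    by (intro sign_patternsI[where v = "\<lambda>i. v i + e * (- u x * u i)"]) auto
qed

text \<open>The third assumption is the other half of general position: values on up to
  \<open>m\<close> coordinates can be prescribed. It supplies a tilt direction at \<open>x\<close>,
  which reverses both inclusions of the upper bound, and the section \<open>v x = 0\<close> inherits
  it with \<open>m\<close> lowered by one.\<close>

lemma card_sign_patterns_ge:
  assumes "finite X" "lin_closed V"
    and "\<And>J y. J \<subseteq> X \<Longrightarrow> card J \<le> m \<Longrightarrow> \<exists>v\<in>V. \<forall>i\<in>J. v i = y i"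
  shows "(\<Sum>l<m. card X choose l) \<le> card (sign_patterns V X)"
  using assms
proof (induction X arbitrary: V m rule: finite_induct)
  case empty
  have "sign_patterns V {} = {{}}"
    using empty(1) by (auto simp: sign_patterns_def lin_closed_def)
  moreover have "(\<Sum>l<m. 0 choose l) \<le> (1::nat)"
    by (cases m) (simp_all only: sum.lessThan_Suc_shift, simp_all)
  ultimately show ?case by simp
next
  case (insert x X)
  show ?case
  proof (cases m)
    case 0
    then show ?thesis by simp
  next
    case (Suc m')
    define W where "W = {v \<in> V. v x = 0}"
    define A where "A = {T \<in> Pow X. T \<in> sign_patterns V (insert x X)}"
    define B where "B = {T \<in> Pow X. insert x T \<in> sign_patterns V (insert x X)}"
    have fin: "finite A" "finite B" using insert.hyps by (auto simp: A_def B_def)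
    \<comment> \<open>Here \<open>m\<close> is positive, so the single coordinate \<open>x\<close>
      can be prescribed.\<close>
    obtain u where u: "u \<in> V" "u x \<noteq> 0"
      using insert.prems(2)[of "{x}" "\<lambda>_. 1"] Suc by auto
    note zero = sign_patterns_insert_zero[OF insert.hyps insert.prems(1) u]
    have "sign_patterns V X \<subseteq> A \<union> B"
    proof
      fix T assume "T \<in> sign_patterns V X"
      then obtain v where T: "T \<subseteq> X" and v: "v \<in> V" "\<forall>i\<in>T. 0 < v i" "\<forall>i\<in>X - T. v i < 0"
        by (auto simp: sign_patterns_def)
      have xT: "x \<notin> T" using T insert.hyps by auto
      consider "v x = 0" | "v x < 0" | "v x > 0" by linarith
      then show "T \<in> A \<union> B"
      proof cases
        case 1
        then show ?thesis using zero(1)[OF T v(1)] v T unfolding A_def by blast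
      next
        case 2
        then have "T \<in> sign_patterns V (insert x X)"
          using v T by (intro sign_patternsI[of _ _ v]) auto
        then show ?thesis using T unfolding A_def by blast
      next
        case 3
        then have "insert x T \<in> sign_patterns V (insert x X)"
          using v T by (intro sign_patternsI[of _ _ v]) auto
        then show ?thesis using T unfolding B_def by blast
      qed
    qed
    then have "card (sign_patterns V X) \<le> card (A \<union> B)"
      using fin by (intro card_mono) auto
    moreover have "(\<Sum>l<m. card X choose l) \<le> card (sign_patterns V X)"
    proof (rule insert.IH[OF insert.prems(1)])
      fix J :: "'a set" and y :: "'a \<Rightarrow> real" assume "J \<subseteq> X" "card J \<le> m"
      then show "\<exists>v\<in>V. \<forall>i\<in>J. v i = y i" using insert.prems(2)[of J y] by auto
    qed
    ultimately have 1: "(\<Sum>l<m. card X choose l) \<le> card (A \<union> B)" by linarith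
    have "sign_patterns W X \<subseteq> A \<inter> B"
    proof
      fix T assume "T \<in> sign_patterns W X"
      then obtain v where T: "T \<subseteq> X" and v: "v \<in> V" "v x = 0" "\<forall>i\<in>T. 0 < v i" "\<forall>i\<in>X - T. v i < 0"
        by (auto simp: sign_patterns_def W_def)
      then show "T \<in> A \<inter> B" using zero[OF T v] T unfolding A_def B_def by blast
    qed
    then have "card (sign_patterns W X) \<le> card (A \<inter> B)"
      using fin by (intro card_mono) auto
    moreover have "(\<Sum>l<m'. card X choose l) \<le> card (sign_patterns W X)"
    proof (rule insert.IH)
      show "lin_closed W" unfolding W_def by (rule lin_closed_hyperplane[OF insert.prems(1)])
      fix J :: "'a set" and y :: "'a \<Rightarrow> real" assume J: "J \<subseteq> X" "card J \<le> m'"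
      have "finite J" "x \<notin> J" using J insert.hyps by (auto intro: finite_subset)
      then have "card (insert x J) \<le> m" using J Suc by simp
      \<comment> \<open>Prescribing 0 at \<open>x\<close> besides the data \<open>y\<close> on
        \<open>J\<close> puts the interpolating vector in \<open>W\<close>.\<close>
      then obtain v where "v \<in> V" "\<forall>i\<in>insert x J. v i = (y(x := 0)) i"
        using insert.prems(2)[of "insert x J" "y(x := 0)"] J by blast
      then show "\<exists>v\<in>W. \<forall>i\<in>J. v i = y i"
        using \<open>x \<notin> J\<close> unfolding W_def by (intro bexI[of _ v]) (auto split: if_splits)
    qed
    ultimately have 2: "(\<Sum>l<m'. card X choose l) \<le> card (A \<inter> B)" by linarith
    have "card (sign_patterns V (insert x X)) = card (A \<union> B) + card (A \<inter> B)"
      unfolding A_def B_def by (rule card_sign_patterns_insert[OF insert.hyps])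
    moreover have "(\<Sum>l<Suc m'. Suc (card X) choose l) = (\<Sum>l<Suc m'. card X choose l) + (\<Sum>l<m'. card X choose l)"
      by (cases m') (simp_all add: lessThan_Suc_atMost sum_choose_Suc del: sum.atMost_Suc sum.lessThan_Suc)
    ultimately show ?thesis
      using 1 2 insert.hyps unfolding Suc by (simp del: sum.lessThan_Suc)
  qed
qed

section \<open>Faces of linear images of coordinate cones\<close>

abbreviation unit_pt :: "nat \<Rightarrow> point" where
  "unit_pt i \<equiv> Poly_Mapping.single i 1"

text \<open>The cone spanned by the unit vectors indexed by \<open>J\<close>: the orthant for
  \<open>J = {..<N}\<close>, and for smaller \<open>J\<close> its faces.\<close>

definition coord_cone :: "nat set \<Rightarrow> point set" where
  "coord_cone J = {x. Poly_Mapping.keys x \<subseteq> J \<and> (\<forall>i. 0 \<le> Poly_Mapping.lookup x i)}"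

lemma lookup_scaleR_point [simp]:
  "Poly_Mapping.lookup (r *\<^sub>R x) i = r * Poly_Mapping.lookup (x :: point) i"
proof -
  have "finite {i. r *\<^sub>R Poly_Mapping.lookup x i \<noteq> 0}"
    by (rule finite_subset[of _ "Poly_Mapping.keys x"]) (auto simp: in_keys_iff)
  then show ?thesis by (simp add: scaleR_poly_mapping_def)
qed

lemma point_expansion:
  assumes "finite J" "Poly_Mapping.keys (x :: point) \<subseteq> J"
  shows "(\<Sum>i\<in>J. Poly_Mapping.lookup x i *\<^sub>R unit_pt i) = x"
proof (rule poly_mapping_eqI)
  fix j
  have "Poly_Mapping.lookup (\<Sum>i\<in>J. Poly_Mapping.lookup x i *\<^sub>R unit_pt i) j
      = (\<Sum>i\<in>J. if i = j then Poly_Mapping.lookup x i else 0)"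
    unfolding lookup_sum by (intro sum.cong) (auto simp: lookup_single)
  also have "\<dots> = Poly_Mapping.lookup x j"
    using assms by (auto simp: in_keys_iff subset_iff)
  finally show "Poly_Mapping.lookup (\<Sum>i\<in>J. Poly_Mapping.lookup x i *\<^sub>R unit_pt i) j = Poly_Mapping.lookup x j" .
qed

lemma linear_point_expansion:
  assumes "linear L" "finite J" "Poly_Mapping.keys (x :: point) \<subseteq> J"
  shows "L x = (\<Sum>i\<in>J. Poly_Mapping.lookup x i *\<^sub>R L (unit_pt i))"
proof -
  have "L x = L (\<Sum>i\<in>J. Poly_Mapping.lookup x i *\<^sub>R unit_pt i)"
    by (simp only: point_expansion[OF assms(2,3)])
  also have "\<dots> = (\<Sum>i\<in>J. Poly_Mapping.lookup x i *\<^sub>R L (unit_pt i))"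
    using assms(1) by (simp add: linear_sum linear_cmul o_def)
  finally show ?thesis .
qed

lemma orthant_eq_coord_cone: "orthant N = coord_cone {..<N}"
  unfolding orthant_def euclid_def coord_cone_def
  by (auto simp: in_keys_iff subset_iff) (metis not_less order_refl)

text \<open>For a set through the origin the affine hull is the span. Translating an affine basis by
  one of its points gives a linear basis, and adjoining 0 to a linear basis gives an affine
  one.\<close>

lemma has_aff_dim_iff_basis:
  assumes "0 \<in> G"
  shows "has_aff_dim G d \<longleftrightarrow> (\<exists>E. finite E \<and> independent E \<and> card E = d \<and> span E = span G)"
proof
  have hG: "affine hull G = span G"
    using assms by (simp add: affine_hull_span_0 hull_inc)
  {
    assume "has_aff_dim G d"
    then obtain B where B: "affine hull B = span G" "\<not> affine_dependent B" "card B = d + 1"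
      unfolding has_aff_dim_def hG by blast
    then obtain b where b: "b \<in> B" by fastforce
    have finB: "finite B" using B(3) card.infinite by fastforce
    define E where "E = (\<lambda>x. - b + x) ` (B - {b})"
    have "independent E" using affine_dependent_iff_dependent2[OF b] B(2) by (simp add: E_def)
    moreover have "finite E" using finB by (simp add: E_def)
    moreover have "card E = d" using b B(3) finB by (simp add: E_def card_image)
    moreover have "span E = span G"
    proof -
      have eq: "span G = (\<lambda>x. b + x) ` span E"
        using affine_hull_span2[OF b] B(1) by (simp add: E_def)
      \<comment> \<open>The translate by \<open>b\<close> contains 0, hence \<open>b\<close> lies in
        \<open>span E\<close> and the translation changes nothing.\<close>
      have "0 \<in> (\<lambda>x. b + x) ` span E" using span_zero[of G] unfolding eq .
      then have "- b \<in> span E" by (metis add_eq_0_iff imageE)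
      then have "b \<in> span E" using span_neg by fastforce
      then have "(\<lambda>x. b + x) ` span E = span E"
        using span_add span_diff by (auto intro!: image_eqI[of _ _ "_ - b"])
      then show ?thesis using eq by simp
    qed
    ultimately show "\<exists>E. finite E \<and> independent E \<and> card E = d \<and> span E = span G"
      by blast
  next
    assume "\<exists>E. finite E \<and> independent E \<and> card E = d \<and> span E = span G"
    then obtain E where E: "finite E" "independent E" "card E = d" "span E = span G" by blast
    have "0 \<notin> E" using E(2) dependent_zero by blast
    moreover have "affine hull (insert 0 E) = span G"
      using E(4) by (simp add: affine_hull_span_0 hull_inc)
    moreover have "\<not> affine_dependent (insert 0 E)"
      using affine_dependent_iff_dependent[OF \<open>0 \<notin> E\<close>] E(2) by simp
    ultimately show "has_aff_dim G d"
      unfolding has_aff_dim_def hG using E by (intro exI[of _ "insert 0 E"]) simp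
  }
qed

text \<open>The point \<open>a + b\<close> is the midpoint of \<open>2 a\<close> and
  \<open>2 b\<close>, both in the cone, so the face contains \<open>2 a\<close> and, being a cone
  itself, \<open>a\<close>.\<close>

lemma face_of_conic_summand:
  fixes S :: "'v :: real_vector set"
  assumes S: "conic S" and G: "G face_of S" and ab: "a \<in> S" "b \<in> S" "a + b \<in> G"
  shows "a \<in> G"
proof -
  have "2 *\<^sub>R a \<in> G"
  proof (cases "a = b")
    \<comment> \<open>The open segment is empty here, but then \<open>a + b\<close> is itself
      \<open>2 a\<close>.\<close>
    case True
    then show ?thesis using ab by (simp add: scaleR_2)
  next
    case False
    have "a + b \<in> open_segment (2 *\<^sub>R a) (2 *\<^sub>R b)"
      using False by (auto simp: in_segment intro!: exI[of _ "1/2"])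
    moreover have "2 *\<^sub>R a \<in> S" "2 *\<^sub>R b \<in> S" using S ab by (auto simp: conic_def)
    ultimately show ?thesis using face_ofD[OF G] ab(3) by blast
  qed
  moreover have "conic G" by (rule face_of_conic[OF S G])
  ultimately have "(1/2) *\<^sub>R (2 *\<^sub>R a) \<in> G" unfolding conic_def by (metis divide_nonneg_nonneg zero_le_numeral zero_le_one)
  then show ?thesis by simp
qed

lemma convex_conic_sum:
  fixes G :: "'v :: real_vector set"
  assumes "convex G" "conic G" "0 \<in> G" "finite J" "\<And>i. i \<in> J \<Longrightarrow> f i \<in> G" "\<And>i. i \<in> J \<Longrightarrow> 0 \<le> c i"
  shows "(\<Sum>i\<in>J. c i *\<^sub>R f i) \<in> G"
  using assms(4-6)
proof (induction J rule: finite_induct)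
  case empty
  then show ?case using assms(3) by simp
next
  case (insert x J)
  have "c x *\<^sub>R f x \<in> G" "(\<Sum>i\<in>J. c i *\<^sub>R f i) \<in> G"
    using insert assms(2) by (auto simp: conic_def)
  \<comment> \<open>Convexity yields half of the sum, and conicity doubles it.\<close>
  then have "(1/2) *\<^sub>R (c x *\<^sub>R f x) + (1/2) *\<^sub>R (\<Sum>i\<in>J. c i *\<^sub>R f i) \<in> G"
    using assms(1) by (intro convexD) auto
  then have "2 *\<^sub>R ((1/2) *\<^sub>R (c x *\<^sub>R f x) + (1/2) *\<^sub>R (\<Sum>i\<in>J. c i *\<^sub>R f i)) \<in> G"
    using assms(2) unfolding conic_def by (metis zero_le_numeral)
  then show ?case using insert by (simp add: scaleR_right_distrib)
qed

lemma zero_in_coord_cone: "0 \<in> coord_cone J"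
  by (simp add: coord_cone_def)

lemma convex_coord_cone: "convex (coord_cone J)"
  unfolding convex_def coord_cone_def by (auto simp: in_keys_iff lookup_add subset_iff) (metis add.right_neutral mult_zero_right)

lemma conic_coord_cone: "conic (coord_cone J)"
  unfolding conic_def coord_cone_def by (auto simp: in_keys_iff subset_iff)

lemma unit_pt_in_coord_cone: "i \<in> J \<Longrightarrow> unit_pt i \<in> coord_cone J"
  by (auto simp: coord_cone_def lookup_single when_def)

text \<open>Splitting coordinate \<open>i\<close> off \<open>x\<close> writes \<open>L x\<close> as
  a sum of two points of the image cone; the face contains the summand, and rescaling leaves the
  image of the unit vector.\<close>

lemma face_of_image_unit:
  assumes L: "linear L" and G: "G face_of L ` coord_cone X"
    and x: "x \<in> coord_cone X" "L x \<in> G" "Poly_Mapping.lookup x i \<noteq> 0"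
  shows "i \<in> X" "L (unit_pt i) \<in> G"
proof -
  let ?c = "Poly_Mapping.lookup x i"
  show iX: "i \<in> X" using x by (auto simp: coord_cone_def in_keys_iff subset_iff)
  have c: "?c > 0" using x by (auto simp: coord_cone_def order_less_le)
  have con: "conic (L ` coord_cone X)" using conic_coord_cone L
    by (simp add: conic_linear_image)
  have "?c *\<^sub>R unit_pt i \<in> coord_cone X"
    using unit_pt_in_coord_cone[OF iX] conic_coord_cone c unfolding conic_def by simp
  moreover have "x - ?c *\<^sub>R unit_pt i \<in> coord_cone X"
    using x(1) iX unfolding coord_cone_def
    by (auto simp: in_keys_iff subset_iff lookup_minus lookup_single when_def)
  moreover have "L (?c *\<^sub>R unit_pt i) + L (x - ?c *\<^sub>R unit_pt i) = L x"
    using L by (simp add: linear_diff)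
  ultimately have "L (?c *\<^sub>R unit_pt i) \<in> G"
    using face_of_conic_summand[OF con G] x(2) by (metis image_eqI)
  then have "?c *\<^sub>R L (unit_pt i) \<in> G" using L by (simp add: linear_cmul)
  then have "(1 / ?c) *\<^sub>R (?c *\<^sub>R L (unit_pt i)) \<in> G"
    using face_of_conic[OF con G] c unfolding conic_def
    by (metis less_imp_le zero_le_divide_1_iff)
  then show "L (unit_pt i) \<in> G" using c by simp
qed

text \<open>A nonempty face is generated by the images of unit vectors that it contains, since every
  unit vector used by a preimage of one of its points is mapped into it.\<close>

lemma face_of_image_coord_cone:
  assumes L: "linear L" and X: "finite X" and G: "G face_of L ` coord_cone X" "G \<noteq> {}"
  shows "G = L ` coord_cone {i \<in> X. L (unit_pt i) \<in> G}"
proof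
  have con: "conic (L ` coord_cone X)" using conic_coord_cone L
    by (simp add: conic_linear_image)
  have conG: "conic G" by (rule face_of_conic[OF con G(1)])
  obtain g where "g \<in> G" using G(2) by blast
  then have "0 *\<^sub>R g \<in> G" using conG unfolding conic_def by blast
  then have 0: "0 \<in> G" by simp
  show "G \<subseteq> L ` coord_cone {i \<in> X. L (unit_pt i) \<in> G}"
  proof
    fix g assume g: "g \<in> G"
    then obtain x where x: "x \<in> coord_cone X" "g = L x" using face_of_imp_subset[OF G(1)] by auto
    have "x \<in> coord_cone {i \<in> X. L (unit_pt i) \<in> G}"
      using x face_of_image_unit[OF L G(1) x(1)] g unfolding coord_cone_def
      by (auto simp: in_keys_iff)
    then show "g \<in> L ` coord_cone {i \<in> X. L (unit_pt i) \<in> G}" using x by blast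
  qed
  show "L ` coord_cone {i \<in> X. L (unit_pt i) \<in> G} \<subseteq> G"
  proof
    fix g assume "g \<in> L ` coord_cone {i \<in> X. L (unit_pt i) \<in> G}"
    then obtain x where x: "x \<in> coord_cone {i \<in> X. L (unit_pt i) \<in> G}" "g = L x" by blast
    have "g = (\<Sum>i\<in>{i \<in> X. L (unit_pt i) \<in> G}. Poly_Mapping.lookup x i *\<^sub>R L (unit_pt i))"
      using linear_point_expansion[OF L, of "{i \<in> X. L (unit_pt i) \<in> G}" x] x X
      by (simp add: coord_cone_def)
    also have "\<dots> \<in> G"
      by (rule convex_conic_sum[OF face_of_imp_convex[OF G(1)] conG 0])
        (use X x in \<open>auto simp: coord_cone_def\<close>)
    finally show "g \<in> G" .
  qed
qed

lemma span_image_coord_cone: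
  assumes "linear L" "finite J"
  shows "span (L ` coord_cone J) = span ((\<lambda>i. L (unit_pt i)) ` J)"
proof (rule span_eq[THEN iffD2], intro conjI subsetI)
  fix g assume "g \<in> L ` coord_cone J"
  then obtain x where x: "x \<in> coord_cone J" "g = L x" by blast
  then have "g = (\<Sum>i\<in>J. Poly_Mapping.lookup x i *\<^sub>R L (unit_pt i))"
    using linear_point_expansion[OF assms, of x] by (simp add: coord_cone_def)
  then show "g \<in> span ((\<lambda>i. L (unit_pt i)) ` J)"
    by (simp add: span_sum span_scale span_base)
next
  fix g assume "g \<in> (\<lambda>i. L (unit_pt i)) ` J"
  then show "g \<in> span (L ` coord_cone J)"
    using unit_pt_in_coord_cone by (auto intro: span_base)
qed

text \<open>The spark condition of sparse recovery, in kernel form: images of at most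
  \<open>k\<close> distinct unit vectors from \<open>X\<close> are linearly independent.\<close>

definition sparse_injective :: "nat \<Rightarrow> nat set \<Rightarrow> (point \<Rightarrow> point) \<Rightarrow> bool" where
  "sparse_injective k X L \<longleftrightarrow>
     (\<forall>x. Poly_Mapping.keys x \<subseteq> X \<and> card (Poly_Mapping.keys x) \<le> k \<and> L x = 0 \<longrightarrow> x = 0)"

lemma sparse_injectiveD:
  assumes "sparse_injective k X L" "J \<subseteq> X" "finite J" "card J \<le> k" "Poly_Mapping.keys x \<subseteq> J" "L x = 0"
  shows "x = 0"
  using assms card_mono[OF assms(3,5)] unfolding sparse_injective_def
  by (meson le_trans subset_trans)

text \<open>The coefficients of a linear relation among these images form a kernel vector supported
  on \<open>J\<close>, which must be 0.\<close>

lemma sparse_injective_independent: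
  assumes L: "linear L" and inj: "sparse_injective k X L" and J: "J \<subseteq> X" "finite J" "card J \<le> k"
  shows "inj_on (\<lambda>i. L (unit_pt i)) J" "independent ((\<lambda>i. L (unit_pt i)) ` J)"
proof -
  have zero: "\<forall>i\<in>J. u i = 0" if "(\<Sum>i\<in>J. u i *\<^sub>R L (unit_pt i)) = 0" for u
  proof -
    define x where "x = (\<Sum>i\<in>J. u i *\<^sub>R unit_pt i)"
    have lx: "Poly_Mapping.lookup x j = (if j \<in> J then u j else 0)" for j
    proof -
      have "Poly_Mapping.lookup x j = (\<Sum>i\<in>J. if i = j then u i else 0)"
        unfolding x_def lookup_sum by (intro sum.cong) (auto simp: lookup_single)
      then show ?thesis using J(2) by simp
    qed
    have "L x = 0" using that L by (simp add: x_def linear_sum linear_cmul)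
    moreover have "Poly_Mapping.keys x \<subseteq> J" by (auto simp: in_keys_iff lx split: if_splits)
    ultimately have "x = 0" using sparse_injectiveD[OF inj J] by blast
    then show ?thesis using lx by (metis lookup_zero)
  qed
  show inj': "inj_on (\<lambda>i. L (unit_pt i)) J"
  proof (rule inj_onI, rule ccontr)
    fix i j assume ij: "i \<in> J" "j \<in> J" "L (unit_pt i) = L (unit_pt j)" "i \<noteq> j"
    let ?u = "\<lambda>l. if l = i then 1 else if l = j then - 1 else (0::real)"
    have "(\<Sum>l\<in>J. ?u l *\<^sub>R L (unit_pt l)) = (\<Sum>l\<in>{i, j}. ?u l *\<^sub>R L (unit_pt l))"
      using ij J(2) by (intro sum.mono_neutral_right) auto
    also have "\<dots> = 0" using ij by simp
    finally show False using zero[of ?u] ij by (auto split: if_splits)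
  qed
  show "independent ((\<lambda>i. L (unit_pt i)) ` J)"
  proof
    assume "dependent ((\<lambda>i. L (unit_pt i)) ` J)"
    then obtain u where u: "\<exists>v\<in>(\<lambda>i. L (unit_pt i)) ` J. u v \<noteq> 0"
      "(\<Sum>v\<in>(\<lambda>i. L (unit_pt i)) ` J. u v *\<^sub>R v) = 0"
      using J(2) dependent_finite[of "(\<lambda>i. L (unit_pt i)) ` J"] by auto
    then have "(\<Sum>i\<in>J. u (L (unit_pt i)) *\<^sub>R L (unit_pt i)) = 0"
      by (simp add: sum.reindex[OF inj'])
    then show False using zero[of "\<lambda>i. u (L (unit_pt i))"] u(1) by blast
  qed
qed

text \<open>Otherwise \<open>unit_pt i - x\<close> would be a nonzero kernel vector supported on
  \<open>insert i J\<close>; this extra index is why sparsity \<open>Suc k\<close> is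
  assumed.\<close>

lemma unit_in_image_coord_cone:
  assumes L: "linear L" and inj: "sparse_injective (Suc k) X L"
    and J: "J \<subseteq> X" "finite J" "card J \<le> k" and i: "i \<in> X" "L (unit_pt i) \<in> L ` coord_cone J"
  shows "i \<in> J"
proof (rule ccontr)
  assume "i \<notin> J"
  obtain x where x: "x \<in> coord_cone J" "L (unit_pt i) = L x" using i by blast
  have "Poly_Mapping.keys (unit_pt i - x) \<subseteq> insert i J"
    using x(1) by (auto simp: coord_cone_def in_keys_iff lookup_minus lookup_single when_def subset_iff split: if_splits)
  moreover have "L (unit_pt i - x) = 0" using L x by (simp add: linear_diff)
  moreover have "insert i J \<subseteq> X" "finite (insert i J)" "card (insert i J) \<le> Suc k"
    using J i \<open>i \<notin> J\<close> by auto
  ultimately have "unit_pt i - x = 0" using sparse_injectiveD[OF inj] by blast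
  then have "unit_pt i = x" by simp
  then have "i \<in> Poly_Mapping.keys x" by auto
  then show False using x \<open>i \<notin> J\<close> by (auto simp: coord_cone_def)
qed

text \<open>The kernel criterion for the cone over \<open>I\<close> to stay a face under
  \<open>L\<close>: kernel vectors have no sign restriction on \<open>I\<close> itself.\<close>

definition face_support :: "nat set \<Rightarrow> (point \<Rightarrow> point) \<Rightarrow> nat set \<Rightarrow> bool" where
  "face_support X L I \<longleftrightarrow>
     (\<forall>v. Poly_Mapping.keys v \<subseteq> X \<and> L v = 0 \<and> (\<forall>i\<in>X - I. 0 \<le> Poly_Mapping.lookup v i)
        \<longrightarrow> (\<forall>i\<in>X - I. Poly_Mapping.lookup v i = 0))"

text \<open>A kernel vector nonnegative off \<open>I\<close> becomes a point of the cone after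
  adding a vector on \<open>I\<close>, and its image lies in the candidate face. Conversely, a point
  of the face interior to a segment of the image yields such a kernel vector, and its vanishing off
  \<open>I\<close> confines both endpoints to the face.\<close>

lemma image_coord_cone_face_iff:
  assumes L: "linear L" and inj: "sparse_injective (Suc k) X L" and X: "finite X"
    and I: "I \<subseteq> X" "card I \<le> k"
  shows "L ` coord_cone I face_of L ` coord_cone X \<longleftrightarrow> face_support X L I"
proof
  have finI: "finite I" using I X finite_subset by blast
  assume face: "L ` coord_cone I face_of L ` coord_cone X"
  show "face_support X L I"
    unfolding face_support_def
  proof (intro allI impI ballI; elim conjE)
    fix v i assume v: "Poly_Mapping.keys v \<subseteq> X" "L v = 0"
      "\<forall>i\<in>X - I. 0 \<le> Poly_Mapping.lookup v i" and i: "i \<in> X - I"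
    \<comment> \<open>The absolute values on \<open>I\<close> cancel any negative entries of
      \<open>v\<close> there, while \<open>f\<close> itself stays in
      \<open>coord_cone I\<close>.\<close>
    define f where "f = (\<Sum>j\<in>I. \<bar>Poly_Mapping.lookup v j\<bar> *\<^sub>R unit_pt j)"
    have lf: "Poly_Mapping.lookup f j = (if j \<in> I then \<bar>Poly_Mapping.lookup v j\<bar> else 0)" for j
    proof -
      have "Poly_Mapping.lookup f j = (\<Sum>i\<in>I. if i = j then \<bar>Poly_Mapping.lookup v i\<bar> else 0)"
        unfolding f_def lookup_sum by (intro sum.cong) (auto simp: lookup_single)
      then show ?thesis using finI by simp
    qed
    have f: "f \<in> coord_cone I" by (auto simp: coord_cone_def in_keys_iff lf split: if_splits)
    have vnn: "0 \<le> Poly_Mapping.lookup (v + f) j" for j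
    proof -
      consider "j \<in> I" | "j \<in> X - I" | "j \<notin> X" by blast
      then show ?thesis
      proof cases
        case 3
        then have "Poly_Mapping.lookup v j = 0" using v(1) by (auto simp: in_keys_iff)
        then show ?thesis by (simp add: lookup_add lf)
      qed (use v(3) in \<open>auto simp: lookup_add lf\<close>)
    qed
    have "v + f \<in> coord_cone X"
      using vnn v(1) I(1) unfolding coord_cone_def
      by (auto simp: in_keys_iff lookup_add lf subset_iff split: if_splits)
    moreover have "L (v + f) = L f" using L v(2) by (simp add: linear_add)
    ultimately have "L (unit_pt i) \<in> L ` coord_cone I" if "Poly_Mapping.lookup (v + f) i \<noteq> 0"
      using face_of_image_unit(2)[OF L face] f that by (metis image_eqI)
    then show "Poly_Mapping.lookup v i = 0"
      using unit_in_image_coord_cone[OF L inj I(1) finI I(2)] i by (auto simp: lookup_add lf)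
  qed
next
  assume sup: "face_support X L I"
  have finI: "finite I" using I X finite_subset by blast
  show "L ` coord_cone I face_of L ` coord_cone X"
    unfolding face_of_def
  proof (intro conjI ballI impI)
    show "L ` coord_cone I \<subseteq> L ` coord_cone X"
      using I by (intro image_mono) (auto simp: coord_cone_def)
    show "convex (L ` coord_cone I)"
      by (rule convex_linear_image[OF L convex_coord_cone])
    fix a b c assume "a \<in> L ` coord_cone X" "b \<in> L ` coord_cone X" "c \<in> L ` coord_cone I"
      "c \<in> open_segment a b"
    then obtain x y f t where x: "x \<in> coord_cone X" "a = L x" and y: "y \<in> coord_cone X" "b = L y"
      and f: "f \<in> coord_cone I" "c = L f" and t: "0 < t" "t < 1" "c = (1 - t) *\<^sub>R a + t *\<^sub>R b"
      by (auto simp: in_segment)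
    \<comment> \<open>The difference of two preimages of \<open>c\<close>. Off \<open>I\<close> the
      term \<open>f\<close> vanishes, leaving a nonnegative combination with positive weights, which
      is 0 only if both entries are.\<close>
    define v where "v = (1 - t) *\<^sub>R x + t *\<^sub>R y - f"
    have lv: "Poly_Mapping.lookup v i = (1 - t) * Poly_Mapping.lookup x i + t * Poly_Mapping.lookup y i - Poly_Mapping.lookup f i" for i
      by (simp add: v_def lookup_minus lookup_add)
    have Lv: "L v = 0"
      using L x y f t by (simp add: v_def linear_diff linear_add linear_cmul)
    have kv: "Poly_Mapping.keys v \<subseteq> X"
    proof (rule subsetI, rule ccontr)
      fix i assume "i \<in> Poly_Mapping.keys v" "i \<notin> X"
      moreover from \<open>i \<notin> X\<close> have "i \<notin> I" using I by blast
      moreover have "Poly_Mapping.lookup x i = 0" "Poly_Mapping.lookup y i = 0"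
        "Poly_Mapping.lookup f i = 0"
        using x y f \<open>i \<notin> X\<close> \<open>i \<notin> I\<close> unfolding coord_cone_def by (auto simp: in_keys_iff)
      ultimately show False by (simp add: in_keys_iff lv)
    qed
    have f0: "Poly_Mapping.lookup f i = 0" if "i \<notin> I" for i
      using f that by (auto simp: coord_cone_def in_keys_iff subset_iff)
    have xy: "0 \<le> (1 - t) * Poly_Mapping.lookup x i" "0 \<le> t * Poly_Mapping.lookup y i" for i
      using x y t by (auto simp: coord_cone_def)
    have "0 \<le> Poly_Mapping.lookup v i" if "i \<in> X - I" for i
      using xy[of i] f0[of i] that by (simp add: lv)
    then have v0: "Poly_Mapping.lookup v i = 0" if "i \<in> X - I" for i
      using sup kv Lv that unfolding face_support_def by blast
    have "Poly_Mapping.lookup x i = 0 \<and> Poly_Mapping.lookup y i = 0" if "i \<in> X - I" for i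
    proof -
      have "(1 - t) * Poly_Mapping.lookup x i + t * Poly_Mapping.lookup y i = 0"
        using v0[OF that] f0[of i] that by (simp add: lv)
      then have "(1 - t) * Poly_Mapping.lookup x i = 0" "t * Poly_Mapping.lookup y i = 0"
        using xy[of i] by linarith+
      then show ?thesis using t by simp
    qed
    moreover have "z \<in> coord_cone I" if "z \<in> coord_cone X"
      "\<And>i. i \<in> X - I \<Longrightarrow> Poly_Mapping.lookup z i = 0" for z
      using that unfolding coord_cone_def by (fastforce simp: in_keys_iff)
    ultimately have "x \<in> coord_cone I" "y \<in> coord_cone I"
      using x(1) y(1) by blast+
    then show "a \<in> L ` coord_cone I" "b \<in> L ` coord_cone I" using x y by auto
  qed
qed

text \<open>The map sending \<open>I\<close> to the image of \<open>coord_cone I\<close> is a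
  bijection from admissible index sets to \<open>k\<close>-faces: a face recovers its index set as
  the unit vectors mapped into it, and independence makes its dimension the size of that
  set.\<close>

lemma num_faces_image_coord_cone:
  assumes L: "linear L" and inj: "sparse_injective (Suc k) X L" and X: "finite X"
  shows "num_faces k (L ` coord_cone X) = card {I. I \<subseteq> X \<and> card I = k \<and> face_support X L I}"
proof -
  let ?C = "\<lambda>I. L ` coord_cone I"
  have sub: "{F. F face_of ?C X \<and> has_aff_dim F k} \<subseteq> ?C ` {I. I \<subseteq> X \<and> card I = k \<and> face_support X L I}"
  proof (rule subsetI, elim CollectE conjE)
    fix F assume F: "F face_of ?C X" "has_aff_dim F k"
    have "F \<noteq> {}"
    proof
      assume "F = {}"
      then obtain B where "affine hull B = {}" "card B = k + 1"
        using F(2) unfolding has_aff_dim_def by auto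
      then show False by auto
    qed
    define J where "J = {i \<in> X. L (unit_pt i) \<in> F}"
    have FJ: "F = ?C J"
      unfolding J_def by (rule face_of_image_coord_cone[OF L X F(1) \<open>F \<noteq> {}\<close>])
    have J: "J \<subseteq> X" "finite J" using X by (auto simp: J_def)
    have "0 \<in> F" unfolding FJ using zero_in_coord_cone linear_0[OF L] by (metis image_eqI)
    then obtain E where E: "finite E" "independent E" "card E = k" "span E = span F"
      using has_aff_dim_iff_basis F(2) by blast
    have spF: "span F = span ((\<lambda>i. L (unit_pt i)) ` J)"
      unfolding FJ by (rule span_image_coord_cone[OF L J(2)])
    \<comment> \<open>Independence is available for at most \<open>k + 1\<close> indices, so
      oversized \<open>J\<close> is excluded first: \<open>k + 1\<close> of its images would be
      independent in a span of dimension \<open>k\<close>.\<close>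
    have "card J \<le> k"
    proof (rule ccontr)
      assume "\<not> card J \<le> k"
      then obtain K where K: "K \<subseteq> J" "card K = Suc k"
        by (metis not_less_eq_eq obtain_subset_with_card_n)
      then have K': "K \<subseteq> X" "finite K" "card K \<le> Suc k" using J finite_subset by auto
      note ind = sparse_injective_independent[OF L inj K']
      have "(\<lambda>i. L (unit_pt i)) ` K \<subseteq> span E"
        unfolding E(4) spF using K(1) by (auto intro: span_base)
      then have "card ((\<lambda>i. L (unit_pt i)) ` K) \<le> card E"
        using independent_span_bound[OF E(1) ind(2)] by blast
      then show False using K(2) E(3) by (simp add: card_image[OF ind(1)])
    qed
    then have J': "card J \<le> Suc k" by simp
    note ind = sparse_injective_independent[OF L inj J J']
    have "k = dim (span E)" using dim_span_eq_card_independent[OF E(2)] E(3) by simp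
    also have "\<dots> = card J"
      unfolding E(4) spF by (simp add: dim_span_eq_card_independent[OF ind(2)] card_image[OF ind(1)] del: dim_span)
    finally have "card J = k" by simp
    moreover have "face_support X L J"
      using image_coord_cone_face_iff[OF L inj X J(1)] F(1) FJ \<open>card J \<le> k\<close> by simp
    ultimately show "F \<in> ?C ` {I. I \<subseteq> X \<and> card I = k \<and> face_support X L I}"
      using J FJ by blast
  qed
  have sup: "?C ` {I. I \<subseteq> X \<and> card I = k \<and> face_support X L I} \<subseteq> {F. F face_of ?C X \<and> has_aff_dim F k}"
  proof (rule subsetI, elim imageE CollectE conjE, simp only:)
    fix I assume I: "I \<subseteq> X" "card I = k" "face_support X L I"
    then have fin: "finite I" using X finite_subset by blast
    have le: "card I \<le> Suc k" using I by simp
    note ind = sparse_injective_independent[OF L inj I(1) fin le]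
    have "0 \<in> ?C I" using zero_in_coord_cone linear_0[OF L] by (metis image_eqI)
    moreover have "span ((\<lambda>i. L (unit_pt i)) ` I) = span (?C I)"
      using span_image_coord_cone[OF L fin] by simp
    ultimately have "has_aff_dim (?C I) k"
      using has_aff_dim_iff_basis[of "?C I" k] ind fin I(2)
      by (metis card_image finite_imageI)
    then show "?C I \<in> {F. F face_of ?C X \<and> has_aff_dim F k}"
      using image_coord_cone_face_iff[OF L inj X I(1)] I by simp
  qed
  have "inj_on ?C {I. I \<subseteq> X \<and> card I = k \<and> face_support X L I}"
  proof (rule inj_onI)
    have *: "I \<subseteq> J" if "I \<subseteq> X" "J \<subseteq> X" "card J = k" "?C I = ?C J" for I J
    proof
      fix i assume "i \<in> I"
      then have "L (unit_pt i) \<in> ?C J" using that(4) unit_pt_in_coord_cone by blast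
      then show "i \<in> J"
        using unit_in_image_coord_cone[OF L inj that(2) finite_subset[OF that(2) X]] that \<open>i \<in> I\<close> by auto
    qed
    fix I J assume "I \<in> {I. I \<subseteq> X \<and> card I = k \<and> face_support X L I}"
      "J \<in> {I. I \<subseteq> X \<and> card I = k \<and> face_support X L I}" "?C I = ?C J"
    then show "I = J" using *[of I J] *[of J I] by auto
  qed
  then show ?thesis
    unfolding num_faces_def using sub sup by (metis (no_types, lifting) card_image subset_antisym)
qed

text \<open>The orthant is its image under the identity, whose trivial kernel makes every index set
  admissible.\<close>

lemma num_faces_orthant: "num_faces k (orthant N) = N choose k"
proof -
  have "face_support {..<N} (\<lambda>x. x) I" for I by (auto simp: face_support_def)
  moreover have "sparse_injective (Suc k) {..<N} (\<lambda>x. x)" by (auto simp: sparse_injective_def)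
  ultimately have "num_faces k ((\<lambda>x. x) ` coord_cone {..<N}) = card {I. I \<subseteq> {..<N} \<and> card I = k}"
    by (subst num_faces_image_coord_cone) (auto simp: linear_id[unfolded id_def])
  also have "\<dots> = N choose k" by (simp add: n_subsets)
  finally show ?thesis by (simp add: orthant_eq_coord_cone)
qed

section \<open>Row spaces of matrices with columns in general position\<close>

text \<open>The row space as plain functions. Entries at indices beyond the last column are not cut
  off; the counting looks only at column sets inside \<open>{..<N}\<close>.\<close>

definition row_combinations :: "nat \<Rightarrow> matrix \<Rightarrow> (nat \<Rightarrow> real) set" where
  "row_combinations m B = range (\<lambda>c j. \<Sum>i<m. c i * B (i, j))"

text \<open>The event behind \<open>generic\<close>, for a single matrix and all column sets at
  once.\<close>

definition general_position :: "nat \<Rightarrow> nat \<Rightarrow> matrix \<Rightarrow> bool" where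
  "general_position m N B \<longleftrightarrow>
     (\<forall>J. J \<subseteq> {..<N} \<and> card J = m \<longrightarrow> inj_on (mat_col m B) J \<and> independent (mat_col m B ` J))"

lemma lookup_vec_of [simp]: "Poly_Mapping.lookup (vec_of p f) j = (if j < p then f j else 0)"
proof -
  have "Poly_Mapping.lookup (vec_of p f) j = (\<Sum>i<p. if i = j then f i else 0)"
    unfolding vec_of_def lookup_sum by (intro sum.cong) (auto simp: lookup_single)
  then show ?thesis by simp
qed

lemma linear_mat_vec: "linear (mat_vec p q A)"
proof (rule linearI)
  show "mat_vec p q A (x + y) = mat_vec p q A x + mat_vec p q A y" for x y
    by (rule poly_mapping_eqI) (simp add: mat_vec_def lookup_add distrib_left sum.distrib)
  show "mat_vec p q A (r *\<^sub>R x) = r *\<^sub>R mat_vec p q A x" for r x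
    by (rule poly_mapping_eqI) (simp add: mat_vec_def sum_distrib_left mult_ac)
qed

lemma row_space_iff:
  "x \<in> row_space p q B \<longleftrightarrow>
     (\<exists>c. \<forall>j. Poly_Mapping.lookup x j = (if j < q then \<Sum>i<p. c i * B (i, j) else 0))"
proof
  assume "x \<in> row_space p q B"
  then have "x \<in> span (mat_row q B ` {..<p})" by (simp add: row_space_def)
  then show "\<exists>c. \<forall>j. Poly_Mapping.lookup x j = (if j < q then \<Sum>i<p. c i * B (i, j) else 0)"
  proof (induction rule: span_induct_alt)
    case base
    show ?case by (intro exI[of _ "\<lambda>_. 0"]) simp
  next
    case (step r x y)
    obtain l where l: "l < p" "x = mat_row q B l" using step by blast
    obtain c where c: "\<forall>j. Poly_Mapping.lookup y j = (if j < q then \<Sum>i<p. c i * B (i, j) else 0)"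
      using step by blast
    have "(\<Sum>i<p. (c i + (if i = l then r else 0)) * B (i, j)) = r * B (l, j) + (\<Sum>i<p. c i * B (i, j))" for j
      using l by (simp add: distrib_right sum.distrib if_distrib[of "\<lambda>u. u * _"] cong: if_cong)
    then show ?case
      using l c by (intro exI[of _ "\<lambda>i. c i + (if i = l then r else 0)"]) (auto simp: lookup_add mat_row_def)
  qed
next
  assume "\<exists>c. \<forall>j. Poly_Mapping.lookup x j = (if j < q then \<Sum>i<p. c i * B (i, j) else 0)"
  then obtain c where c: "\<forall>j. Poly_Mapping.lookup x j = (if j < q then \<Sum>i<p. c i * B (i, j) else 0)" by blast
  have "x = (\<Sum>i<p. c i *\<^sub>R mat_row q B i)"
    by (rule poly_mapping_eqI) (simp add: c lookup_sum mat_row_def)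
  then show "x \<in> row_space p q B"
    unfolding row_space_def by (auto intro!: span_sum span_scale intro: span_base)
qed

lemma lin_closed_row_combinations: "lin_closed (row_combinations m B)"
proof -
  have "(\<lambda>j. a * (\<Sum>i<m. c i * B (i, j)) + b * (\<Sum>i<m. d i * B (i, j)))
      = (\<lambda>j. \<Sum>i<m. (a * c i + b * d i) * B (i, j))" for a b c d
    by (simp add: sum_distrib_left sum.distrib distrib_right mult.assoc)
  then show ?thesis
    unfolding lin_closed_def row_combinations_def by auto
qed

lemma mat_col_expansion: "mat_col m B j = (\<Sum>i<m. B (i, j) *\<^sub>R unit_pt i)"
proof (rule poly_mapping_eqI)
  fix l
  have "Poly_Mapping.lookup (\<Sum>i<m. B (i, j) *\<^sub>R unit_pt i) l = (\<Sum>i<m. if i = l then B (i, j) else 0)"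
    unfolding lookup_sum by (intro sum.cong) (auto simp: lookup_single)
  then show "Poly_Mapping.lookup (mat_col m B j) l = Poly_Mapping.lookup (\<Sum>i<m. B (i, j) *\<^sub>R unit_pt i) l"
    by (simp add: mat_col_def)
qed

text \<open>An element of \<open>T\<close> outside \<open>span S\<close> could be adjoined to
  \<open>S\<close>, giving an independent set too large for \<open>span T\<close>.\<close>

lemma independent_card_spans:
  fixes S T :: "'v :: real_vector set"
  assumes "independent S" "finite T" "S \<subseteq> span T" "card T \<le> card S"
  shows "T \<subseteq> span S"
proof (rule subsetI, rule ccontr)
  fix t assume t: "t \<in> T" "t \<notin> span S"
  then have "independent (insert t S)" using assms(1) by (simp add: independent_insertI)
  moreover have "insert t S \<subseteq> span T" using assms(3) t by (auto intro: span_base)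
  ultimately have "finite (insert t S) \<and> card (insert t S) \<le> card T"
    by (rule independent_span_bound[OF assms(2)])
  moreover have "t \<notin> S" using t span_base by blast
  ultimately show False using assms(4) by (auto simp: card_insert_disjoint)
qed

text \<open>The \<open>m\<close> independent columns span the whole \<open>m\<close>-dimensional
  space, so the functional with coefficients \<open>c\<close>, which kills them, kills every unit
  vector.\<close>

lemma general_position_zero:
  assumes gp: "general_position m N B" and J: "J \<subseteq> {..<N}" "card J = m"
    and zero: "\<And>j. j \<in> J \<Longrightarrow> (\<Sum>i<m. c i * B (i, j)) = 0" and i: "i < m"
  shows "c i = 0"
proof -
  have ind: "inj_on (mat_col m B) J" "independent (mat_col m B ` J)"
    using gp J by (auto simp: general_position_def)
  have inj: "inj_on unit_pt {..<m}"
    by (rule inj_onI, drule arg_cong[where f = Poly_Mapping.keys]) simp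
  have "mat_col m B j \<in> span (unit_pt ` {..<m})" for j
    unfolding mat_col_expansion by (intro span_sum span_scale span_base imageI)
  then have "mat_col m B ` J \<subseteq> span (unit_pt ` {..<m})" by blast
  moreover have "card (unit_pt ` {..<m}) \<le> card (mat_col m B ` J)"
    using J(2) by (simp only: card_image[OF ind(1)] card_image[OF inj] card_lessThan)
  ultimately have "unit_pt ` {..<m} \<subseteq> span (mat_col m B ` J)"
    using independent_card_spans[OF ind(2)] by blast
  moreover have "span (mat_col m B ` J) \<subseteq> {x. (\<Sum>i<m. c i * Poly_Mapping.lookup x i) = 0}"
  proof (rule span_minimal)
    show "subspace {x. (\<Sum>i<m. c i * Poly_Mapping.lookup x i) = 0}"
      unfolding subspace_def
      by (auto simp: lookup_add distrib_left sum.distrib mult.left_commute simp flip: sum_distrib_left)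
  qed (use zero in \<open>auto simp: mat_col_def\<close>)
  ultimately have "(\<Sum>l<m. c l * Poly_Mapping.lookup (unit_pt i) l) = 0" using i by blast
  moreover have "(\<Sum>l<m. c l * Poly_Mapping.lookup (unit_pt i) l) = (\<Sum>l<m. if l = i then c l else 0)"
    by (intro sum.cong) (auto simp: lookup_single)
  ultimately show ?thesis using i by simp
qed

text \<open>Enlarge \<open>J\<close> to exactly \<open>m\<close> columns. They are independent, so
  some linear functional takes the prescribed values on them; its values on the unit vectors are the
  coefficients.\<close>

lemma general_position_interpolation:
  assumes gp: "general_position m N B" and X: "X \<subseteq> {..<N}" "m \<le> card X"
    and J: "J \<subseteq> X" "card J \<le> m"
  shows "\<exists>c. \<forall>j\<in>J. (\<Sum>i<m. c i * B (i, j)) = y j"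
proof -
  have "finite X" using X finite_subset by blast
  then obtain K where K: "J \<subseteq> K" "K \<subseteq> X" "card K = m"
    using exists_subset_between[OF J(2) X(2) J(1)] by blast
  have ind: "inj_on (mat_col m B) K" "independent (mat_col m B ` K)"
    using gp K X by (auto simp: general_position_def)
  obtain g :: "point \<Rightarrow> real" where g: "linear g"
    "\<forall>x\<in>mat_col m B ` K. g x = y (the_inv_into K (mat_col m B) x)"
    using linear_independent_extend[OF ind(2), of "\<lambda>x. y (the_inv_into K (mat_col m B) x)"] by auto
  have "(\<Sum>i<m. g (unit_pt i) * B (i, j)) = y j" if "j \<in> J" for j
  proof -
    have "j \<in> K" using K that by blast
    then have "y j = g (mat_col m B j)"
      using g(2) by (simp add: the_inv_into_f_f[OF ind(1)])
    also have "\<dots> = (\<Sum>i<m. g (unit_pt i) * B (i, j))"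
      using g(1) by (simp add: mat_col_expansion linear_sum linear_cmul mult.commute)
    finally show ?thesis by simp
  qed
  then show ?thesis by (intro exI[of _ "\<lambda>i. g (unit_pt i)"]) simp
qed

lemma card_sign_patterns_bounds:
  assumes gp: "general_position m N B" and X: "X \<subseteq> {..<N}" "m \<le> card X"
  shows "(\<Sum>l<m. card X choose l) \<le> card (sign_patterns (row_combinations m B) X)"
    "card (sign_patterns (row_combinations m B) X) \<le> (\<Sum>l\<le>m. card X choose l)"
proof -
  have fin: "finite X" using X finite_subset by blast
  show "(\<Sum>l<m. card X choose l) \<le> card (sign_patterns (row_combinations m B) X)"
  proof (rule card_sign_patterns_ge[OF fin lin_closed_row_combinations])
    fix J y assume "J \<subseteq> X" "card J \<le> m"
    then show "\<exists>v\<in>row_combinations m B. \<forall>i\<in>J. v i = y i"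
      using general_position_interpolation[OF gp X, of J y] by (auto simp: row_combinations_def)
  qed
  show "card (sign_patterns (row_combinations m B) X) \<le> (\<Sum>l\<le>m. card X choose l)"
  proof (rule card_sign_patterns_le[OF fin lin_closed_row_combinations])
    fix J v assume J: "J \<subseteq> X" "card J = m" and v: "v \<in> row_combinations m B" "\<And>i. i \<in> J \<Longrightarrow> v i = 0"
    obtain c where c: "v = (\<lambda>j. \<Sum>i<m. c i * B (i, j))" using v(1) by (auto simp: row_combinations_def)
    have "J \<subseteq> {..<N}" using J X by blast
    then have "c i = 0" if "i < m" for i
      using general_position_zero[OF gp _ J(2) _ that, of c] v(2) c by auto
    then show "\<forall>i\<in>X. v i = 0" by (simp add: c)
  qed
qed

text \<open>A nonzero nonnegative combination has fewer than \<open>m\<close> zeros in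
  \<open>X\<close>. Interpolation provides a combination equal to 1 at those zeros, and a small
  multiple of it makes every coordinate positive.\<close>

lemma positive_pattern_iff_nonneg:
  assumes gp: "general_position m N B" and X: "X \<subseteq> {..<N}" "m \<le> card X" "X \<noteq> {}"
  shows "X \<in> sign_patterns (row_combinations m B) X \<longleftrightarrow>
    (\<exists>v\<in>row_combinations m B. (\<forall>j\<in>X. 0 \<le> v j) \<and> (\<exists>j\<in>X. v j \<noteq> 0))"
proof
  assume "X \<in> sign_patterns (row_combinations m B) X"
  then obtain v where "v \<in> row_combinations m B" "\<forall>j\<in>X. 0 < v j"
    by (auto simp: sign_patterns_def)
  then show "\<exists>v\<in>row_combinations m B. (\<forall>j\<in>X. 0 \<le> v j) \<and> (\<exists>j\<in>X. v j \<noteq> 0)"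
    using X(3) by (metis all_not_in_conv less_imp_le order_less_irrefl)
next
  have fin: "finite X" using X finite_subset by blast
  assume "\<exists>v\<in>row_combinations m B. (\<forall>j\<in>X. 0 \<le> v j) \<and> (\<exists>j\<in>X. v j \<noteq> 0)"
  then obtain v where v: "v \<in> row_combinations m B" "\<forall>j\<in>X. 0 \<le> v j" "\<exists>j\<in>X. v j \<noteq> 0" by blast
  then obtain c where c: "v = (\<lambda>j. \<Sum>i<m. c i * B (i, j))" by (auto simp: row_combinations_def)
  define Z where "Z = {j \<in> X. v j = 0}"
  have "card Z < m"
  proof (rule ccontr)
    assume "\<not> card Z < m"
    then obtain J where J: "J \<subseteq> Z" "card J = m" by (metis not_less obtain_subset_with_card_n)
    have "J \<subseteq> {..<N}" using J X unfolding Z_def by blast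
    moreover have "(\<Sum>i<m. c i * B (i, j)) = 0" if "j \<in> J" for j
      using that J c by (auto simp: Z_def)
    ultimately have "c i = 0" if "i < m" for i
      using general_position_zero[OF gp _ J(2) _ that, of c] by blast
    then show False using v(3) by (simp add: c)
  qed
  then obtain d where d: "\<forall>j\<in>Z. (\<Sum>i<m. d i * B (i, j)) = 1"
    using general_position_interpolation[OF gp X(1,2), of Z "\<lambda>_. 1"] by (auto simp: Z_def)
  define u where "u = (\<lambda>j. \<Sum>i<m. d i * B (i, j))"
  have u: "u \<in> row_combinations m B" by (auto simp: u_def row_combinations_def)
  have pos: "0 < v j" if "j \<in> X - Z" for j using that v(2) by (force simp: Z_def order_less_le)
  obtain e where e: "e > 0" "\<forall>j\<in>X - Z. 0 < v j + e * u j"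
    using positive_perturbation[of "X - Z" v u] fin pos by auto
  have "0 < v j + e * u j" if "j \<in> X" for j
  proof (cases "j \<in> Z")
    case True
    then show ?thesis using d e(1) by (simp add: u_def Z_def)
  qed (use e that in auto)
  moreover have "(\<lambda>j. v j + e * u j) \<in> row_combinations m B"
    using lin_closedD[OF lin_closed_row_combinations v(1) u, of 1 e] by simp
  ultimately show "X \<in> sign_patterns (row_combinations m B) X"
    unfolding sign_patterns_def by force
qed

section \<open>Faces of the projected orthant for one fixed pair of matrices\<close>

context
  fixes A B :: matrix and k n N :: nat
  assumes kn: "k < n" "n < N"
    and gp: "general_position (N - n) N B"
    and null: "nullspace n N A = row_space (N - n) N B"
begin

text \<open>Since \<open>Suc k \<le> n\<close>, so sparse a kernel vector vanishes on at least
  \<open>N - n\<close> columns; lying in the row space of \<open>B\<close>, it has all coefficients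
  0.\<close>

lemma mat_vec_sparse_injective: "sparse_injective (Suc k) {..<N} (mat_vec n N A)"
  unfolding sparse_injective_def
proof (intro allI impI; elim conjE)
  fix x assume x: "Poly_Mapping.keys x \<subseteq> {..<N}" "card (Poly_Mapping.keys x) \<le> Suc k" "mat_vec n N A x = 0"
  then have "x \<in> row_space (N - n) N B"
    unfolding null[symmetric] by (simp add: nullspace_def euclid_def)
  then obtain c where c: "\<forall>j. Poly_Mapping.lookup x j = (if j < N then \<Sum>i<N - n. c i * B (i, j) else 0)"
    unfolding row_space_iff by blast
  have "card ({..<N} - Poly_Mapping.keys x) = N - card (Poly_Mapping.keys x)"
    using x(1) by (simp add: card_Diff_subset)
  then have "N - n \<le> card ({..<N} - Poly_Mapping.keys x)" using x(2) kn by linarith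
  then obtain J where J: "J \<subseteq> {..<N} - Poly_Mapping.keys x" "card J = N - n"
    by (metis obtain_subset_with_card_n)
  have "(\<Sum>i<N - n. c i * B (i, j)) = 0" if "j \<in> J" for j
  proof -
    have "j < N" "Poly_Mapping.lookup x j = 0" using that J(1) by (auto simp: in_keys_iff)
    then show ?thesis using c by metis
  qed
  moreover have "J \<subseteq> {..<N}" using J by blast
  ultimately have "c i = 0" if "i < N - n" for i
    using general_position_zero[OF gp _ J(2) _ that, of c] by blast
  then show "x = 0" by (intro poly_mapping_eqI) (simp add: c)
qed

text \<open>As the kernel is the row space, the criterion fails exactly when some row combination is
  nonnegative and nonzero off \<open>I\<close>; general position upgrades this to strict
  positivity.\<close>

lemma face_support_iff_pattern:
  assumes I: "I \<subseteq> {..<N}" "card I = k"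
  shows "face_support {..<N} (mat_vec n N A) I \<longleftrightarrow>
    {..<N} - I \<notin> sign_patterns (row_combinations (N - n) B) ({..<N} - I)"
proof -
  let ?X = "{..<N} - I"
  have "card ?X = N - k" using I finite_subset[OF I(1)] by (simp add: card_Diff_subset)
  then have "N - n \<le> card ?X" "0 < card ?X" using kn by linarith+
  then have X: "?X \<subseteq> {..<N}" "N - n \<le> card ?X" "?X \<noteq> {}"
    unfolding card_gt_0_iff by blast+
  have "face_support {..<N} (mat_vec n N A) I \<longleftrightarrow>
     \<not> (\<exists>v\<in>row_space (N - n) N B. (\<forall>j\<in>?X. 0 \<le> Poly_Mapping.lookup v j) \<and> (\<exists>j\<in>?X. Poly_Mapping.lookup v j \<noteq> 0))"
    unfolding null[symmetric] face_support_def nullspace_def euclid_def by blast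
  also have "(\<exists>v\<in>row_space (N - n) N B. (\<forall>j\<in>?X. 0 \<le> Poly_Mapping.lookup v j) \<and> (\<exists>j\<in>?X. Poly_Mapping.lookup v j \<noteq> 0))
     \<longleftrightarrow> (\<exists>v\<in>row_combinations (N - n) B. (\<forall>j\<in>?X. 0 \<le> v j) \<and> (\<exists>j\<in>?X. v j \<noteq> 0))"
    (is "?l \<longleftrightarrow> ?r")
  proof
    assume ?l
    then obtain v where v: "v \<in> row_space (N - n) N B" "\<forall>j\<in>?X. 0 \<le> Poly_Mapping.lookup v j"
      "\<exists>j\<in>?X. Poly_Mapping.lookup v j \<noteq> 0" by blast
    obtain c where c: "\<forall>j. Poly_Mapping.lookup v j = (if j < N then \<Sum>i<N - n. c i * B (i, j) else 0)"
      using v(1) unfolding row_space_iff by blast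
    show ?r
      using v(2,3) c by (intro bexI[of _ "\<lambda>j. \<Sum>i<N - n. c i * B (i, j)"]) (auto simp: row_combinations_def)
  next
    assume ?r
    then obtain c where c: "\<forall>j\<in>?X. 0 \<le> (\<Sum>i<N - n. c i * B (i, j))"
      "\<exists>j\<in>?X. (\<Sum>i<N - n. c i * B (i, j)) \<noteq> 0" by (auto simp: row_combinations_def)
    have "vec_of N (\<lambda>j. \<Sum>i<N - n. c i * B (i, j)) \<in> row_space (N - n) N B"
      unfolding row_space_iff by (intro exI[of _ c]) simp
    then show ?l
      using c by (intro bexI[of _ "vec_of N (\<lambda>j. \<Sum>i<N - n. c i * B (i, j))"]) auto
  qed
  finally show ?thesis using positive_pattern_iff_nonneg[OF gp X] by simp
qed

lemma num_faces_image_orthant: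
  "num_faces k (mat_vec n N A ` orthant N) =
     card {I. I \<subseteq> {..<N} \<and> card I = k \<and>
       {..<N} - I \<notin> sign_patterns (row_combinations (N - n) B) ({..<N} - I)}"
proof -
  have "num_faces k (mat_vec n N A ` orthant N)
      = card {I. I \<subseteq> {..<N} \<and> card I = k \<and> face_support {..<N} (mat_vec n N A) I}"
    unfolding orthant_eq_coord_cone
    by (rule num_faces_image_coord_cone[OF linear_mat_vec mat_vec_sparse_injective]) simp
  also have "{I. I \<subseteq> {..<N} \<and> card I = k \<and> face_support {..<N} (mat_vec n N A) I} =
    {I. I \<subseteq> {..<N} \<and> card I = k \<and>
       {..<N} - I \<notin> sign_patterns (row_combinations (N - n) B) ({..<N} - I)}"
    using face_support_iff_pattern by blast
  finally show ?thesis .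
qed

end

section \<open>Tails of the symmetric binomial distribution\<close>

text \<open>Chebyshev's inequality: the Bernstein polynomials at 1/2 are the weights of the
  symmetric binomial distribution, whose variance is \<open>M / 4\<close>.\<close>

lemma binomial_deviation_bound:
  fixes M :: nat and t :: real
  assumes "0 < t" "S \<subseteq> {..M}" "\<And>l. l \<in> S \<Longrightarrow> t \<le> \<bar>real l - real M / 2\<bar>"
  shows "(\<Sum>l\<in>S. real (M choose l)) / 2 ^ M \<le> real M / (4 * t\<^sup>2)"
proof -
  have B: "Bernstein M l (1/2) = real (M choose l) / 2 ^ M" if "l \<le> M" for l
  proof -
    have "(1/2::real) ^ l * (1/2) ^ (M - l) = (1/2) ^ M"
      using that by (simp flip: power_add)
    then show ?thesis by (simp add: Bernstein_def power_one_over mult.assoc)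
  qed
  have var: "(\<Sum>l\<le>M. (real l - real M * x)\<^sup>2 * Bernstein M l x) = real M * x * (1 - x)" for x
  proof -
    \<comment> \<open>Splits the square into the factorial moments \<open>a * (a - 1)\<close> and
      \<open>a\<close> and a constant, whose sums against Bernstein polynomials have closed
      forms.\<close>
    have *: "\<And>a b x::real. (a - b)\<^sup>2 * x = a * (a - 1) * x + (1 - 2 * b) * a * x + b * b * x"
      by (simp add: algebra_simps power2_eq_square)
    show ?thesis
      apply (simp add: * sum.distrib)
      apply (simp flip: sum_distrib_left add: mult.assoc)
      apply (simp add: algebra_simps power2_eq_square)
      done
  qed
  have "t\<^sup>2 * (\<Sum>l\<in>S. Bernstein M l (1/2)) \<le> (\<Sum>l\<in>S. (real l - real M * (1/2))\<^sup>2 * Bernstein M l (1/2))"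
    unfolding sum_distrib_left
  proof (intro sum_mono mult_right_mono)
    fix l assume "l \<in> S"
    then have "t \<le> \<bar>real l - real M * (1/2)\<bar>" using assms(3) by simp
    then show "t\<^sup>2 \<le> (real l - real M * (1/2))\<^sup>2"
      using assms(1) by (metis abs_le_square_iff abs_of_pos)
  qed (simp add: Bernstein_nonneg)
  also have "\<dots> \<le> (\<Sum>l\<le>M. (real l - real M * (1/2))\<^sup>2 * Bernstein M l (1/2))"
    using assms(2) by (intro sum_mono2) (auto simp: Bernstein_nonneg)
  finally have "t\<^sup>2 * (\<Sum>l\<in>S. Bernstein M l (1/2)) \<le> real M / 4" using var[of "1/2"] by simp
  moreover have "(\<Sum>l\<in>S. Bernstein M l (1/2)) = (\<Sum>l\<in>S. real (M choose l)) / 2 ^ M"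
    unfolding sum_divide_distrib using assms(2) B by (intro sum.cong) auto
  ultimately show ?thesis using assms(1) by (simp add: field_simps)
qed

lemma binomial_lower_tail:
  assumes "real m < real M / 2"
  shows "(\<Sum>l\<le>m. real (M choose l)) / 2 ^ M \<le> real M / (4 * (real M / 2 - real m)\<^sup>2)"
  using assms by (intro binomial_deviation_bound) auto

lemma binomial_upper_tail:
  assumes "real M / 2 < real m" "m \<le> M"
  shows "1 - (\<Sum>l<m. real (M choose l)) / 2 ^ M \<le> real M / (4 * (real M / 2 - real m)\<^sup>2)"
proof -
  have "(\<Sum>l\<le>M. real (M choose l)) = (\<Sum>l<m. real (M choose l)) + (\<Sum>l\<in>{m..M}. real (M choose l))"
    using assms(2) by (subst sum.union_disjoint[symmetric]) (auto intro!: sum.cong)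
  moreover have "(\<Sum>l\<le>M. real (M choose l)) = 2 ^ M"
    by (metis choose_row_sum of_nat_numeral of_nat_power of_nat_sum)
  ultimately have "(\<Sum>l\<in>{m..M}. real (M choose l)) = 2 ^ M - (\<Sum>l<m. real (M choose l))"
    by linarith
  then have "1 - (\<Sum>l<m. real (M choose l)) / 2 ^ M = (\<Sum>l\<in>{m..M}. real (M choose l)) / 2 ^ M"
    by (simp add: diff_divide_distrib)
  also have "\<dots> \<le> real M / (4 * (real m - real M / 2)\<^sup>2)"
    using assms by (intro binomial_deviation_bound) auto
  finally show ?thesis by (simp add: power2_commute)
qed

text \<open>Dividing out \<open>M n\<close> leaves a factor \<open>1 / M n\<close> times a factor
  that converges because \<open>r\<close> differs from 1/2.\<close>

lemma deviation_bound_tendsto_0: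
  fixes m M :: "nat \<Rightarrow> nat"
  assumes r: "(\<lambda>n. real (m n) / real (M n)) \<longlonglongrightarrow> r" "r \<noteq> 1/2"
    and M: "filterlim (\<lambda>n. real (M n)) at_top sequentially"
  shows "(\<lambda>n. real (M n) / (4 * (real (M n) / 2 - real (m n))\<^sup>2)) \<longlonglongrightarrow> 0"
proof -
  have lim: "(\<lambda>n. (1 / (4 * (1/2 - real (m n) / real (M n))\<^sup>2)) * (1 / real (M n)))
      \<longlonglongrightarrow> (1 / (4 * (1/2 - r)\<^sup>2)) * 0"
    using r M by (intro tendsto_intros tendsto_divide_0[OF tendsto_const]
        filterlim_at_top_imp_at_infinity) auto
  have "\<forall>\<^sub>F n in sequentially. 0 < real (M n)"
    using M unfolding filterlim_at_top_dense by blast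
  then have "\<forall>\<^sub>F n in sequentially. (1 / (4 * (1/2 - real (m n) / real (M n))\<^sup>2)) * (1 / real (M n))
      = real (M n) / (4 * (real (M n) / 2 - real (m n))\<^sup>2)"
  proof eventually_elim
    case (elim n)
    have "real (M n) / 2 - real (m n) = real (M n) * (1/2 - real (m n) / real (M n))"
      using elim by (simp add: field_simps)
    then have "real (M n) / (4 * (real (M n) / 2 - real (m n))\<^sup>2) =
      real (M n) / (4 * (real (M n) * (1/2 - real (m n) / real (M n)))\<^sup>2)" by (simp only:)
    also have "\<dots> = (1 / (4 * (1/2 - real (m n) / real (M n))\<^sup>2)) * (1 / real (M n))"
      using elim by (simp add: power_mult_distrib power2_eq_square)
    finally show ?case by simp
  qed
  then show ?thesis using Lim_transform_eventually[OF lim] by simp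
qed

section \<open>Asymptotics of the ratio of codimensions\<close>

context
  fixes \<rho> \<delta> :: real and k N :: "nat \<Rightarrow> nat"
  assumes rd: "\<rho> < 1" "0 < \<delta>" "\<delta> < 1"
    and kN: "\<And>n. n \<ge> 1 \<Longrightarrow> k n < n \<and> n < N n"
    and k_lim: "(\<lambda>n. real (k n) / real n) \<longlonglongrightarrow> \<rho>"
    and N_lim: "(\<lambda>n. real n / real (N n)) \<longlonglongrightarrow> \<delta>"
begin

lemma codim_filterlim: "filterlim (\<lambda>n. real (N n - k n)) at_top sequentially"
proof -
  have lim: "(\<lambda>n. 1 - real (k n) / real n) \<longlonglongrightarrow> 1 - \<rho>"
    by (intro tendsto_intros k_lim)
  then have "filterlim (\<lambda>n. (1 - real (k n) / real n) * real n) at_top sequentially"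
    using rd by (intro filterlim_tendsto_pos_mult_at_top[OF lim _ filterlim_real_sequentially]) auto
  then show ?thesis
  proof (rule filterlim_at_top_mono)
    show "\<forall>\<^sub>F n in sequentially. (1 - real (k n) / real n) * real n \<le> real (N n - k n)"
      using eventually_ge_at_top[of 1]
    proof eventually_elim
      case (elim n)
      then show ?case using kN[OF elim] by (simp add: left_diff_distrib of_nat_diff)
    qed
  qed
qed

text \<open>Divide numerator and denominator by \<open>N n\<close> and write \<open>k / N\<close> as
  \<open>(k / n) * (n / N)\<close>.\<close>

lemma codim_ratio_tendsto:
  "(\<lambda>n. real (N n - n) / real (N n - k n)) \<longlonglongrightarrow> (1 - \<delta>) / (1 - \<rho> * \<delta>)"
proof -
  \<comment> \<open>The limiting denominator must be nonzero; the sign of \<rho> is not fixed in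
    this context, hence the two cases.\<close>
  have "\<rho> * \<delta> < 1"
  proof (cases "\<rho> \<le> 0")
    case True
    then show ?thesis using rd by (smt (verit) mult_nonpos_nonneg)
  next
    case False
    then show ?thesis using rd mult_strict_mono[of \<rho> 1 \<delta> 1] by simp
  qed
  then have "(\<lambda>n. (1 - real n / real (N n)) / (1 - (real (k n) / real n) * (real n / real (N n))))
      \<longlonglongrightarrow> (1 - \<delta>) / (1 - \<rho> * \<delta>)"
    by (intro tendsto_intros k_lim N_lim) simp
  moreover have "\<forall>\<^sub>F n in sequentially.
      (1 - real n / real (N n)) / (1 - (real (k n) / real n) * (real n / real (N n)))
      = real (N n - n) / real (N n - k n)"
    using eventually_ge_at_top[of 1]
  proof eventually_elim
    case (elim n)
    have "real (N n) > 0" "real n > 0" using kN[OF elim] elim by auto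
    then have "1 - real n / real (N n) = real (N n - n) / real (N n)"
      "1 - (real (k n) / real n) * (real n / real (N n)) = real (N n - k n) / real (N n)"
      using kN[OF elim] by (auto simp: of_nat_diff field_simps)
    then show ?case using \<open>real (N n) > 0\<close> by simp
  qed
  ultimately show ?thesis by (rule Lim_transform_eventually)
qed

text \<open>The origin of the threshold: clearing the positive denominator turns the first
  comparison into \<open>2 - 2 * \<delta> < 1 - \<rho> * \<delta>\<close>.\<close>

lemma codim_ratio_less_half_iff:
  "(1 - \<delta>) / (1 - \<rho> * \<delta>) < 1/2 \<longleftrightarrow> \<rho> < 2 - 1 / \<delta>"
  "(1 - \<delta>) / (1 - \<rho> * \<delta>) > 1/2 \<longleftrightarrow> \<rho> > 2 - 1 / \<delta>"
proof -
  have "\<rho> * \<delta> < \<delta>" using rd by simp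
  then have "1 - \<rho> * \<delta> > 0" using rd by linarith
  then show "(1 - \<delta>) / (1 - \<rho> * \<delta>) < 1/2 \<longleftrightarrow> \<rho> < 2 - 1 / \<delta>"
    "(1 - \<delta>) / (1 - \<rho> * \<delta>) > 1/2 \<longleftrightarrow> \<rho> > 2 - 1 / \<delta>"
    using rd by (auto simp: field_simps)
qed

end

section \<open>Orthant-symmetric random matrices\<close>

definition pattern_event :: "nat \<Rightarrow> nat \<Rightarrow> nat set \<Rightarrow> nat set \<Rightarrow> matrix set" where
  "pattern_event m N X T =
     {B \<in> space (matrix_space m N). T \<in> sign_patterns (row_combinations m B) X}"

text \<open>Rational coefficients make the event that a pattern is realised a countable union.\<close>

lemma rational_combination:
  fixes c :: "nat \<Rightarrow> real"
  assumes "finite X" "\<And>j. j \<in> X \<Longrightarrow> 0 < (\<Sum>i<m. c i * b i j)"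
  shows "\<exists>q :: rat list. \<forall>j\<in>X. 0 < (\<Sum>i<m. of_rat (q ! i) * b i j)"
proof -
  have "\<exists>r :: nat \<Rightarrow> rat. (\<lambda>l. of_rat (r l) :: real) \<longlonglongrightarrow> x" for x :: real
  proof -
    have "\<exists>r. x < of_rat r \<and> of_rat r < x + 1 / real (Suc l)" for l
      by (rule of_rat_dense) simp
    then obtain r where r: "\<And>l. x < of_rat (r l)" "\<And>l. of_rat (r l) < x + 1 / real (Suc l)"
      by metis
    have "(\<lambda>l. x + 1 / real (Suc l)) \<longlonglongrightarrow> x + 0"
      by (intro tendsto_intros LIMSEQ_Suc lim_1_over_n)
    then have upper: "(\<lambda>l. x + 1 / real (Suc l)) \<longlonglongrightarrow> x" by simp
    have "(\<lambda>l. of_rat (r l) :: real) \<longlonglongrightarrow> x"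
      by (rule tendsto_sandwich[OF _ _ tendsto_const upper])
        (intro always_eventually allI less_imp_le r)+
    then show ?thesis by blast
  qed
  then have "\<exists>r :: nat \<Rightarrow> nat \<Rightarrow> rat. \<forall>i. (\<lambda>l. of_rat (r i l) :: real) \<longlonglongrightarrow> c i"
    by (intro choice allI)
  then obtain r :: "nat \<Rightarrow> nat \<Rightarrow> rat" where r: "\<And>i. (\<lambda>l. of_rat (r i l)) \<longlonglongrightarrow> c i"
    by auto
  have "\<forall>\<^sub>F l in sequentially. 0 < (\<Sum>i<m. of_rat (r i l) * b i j)" if "j \<in> X" for j
  proof -
    have "(\<lambda>l. \<Sum>i<m. of_rat (r i l) * b i j) \<longlonglongrightarrow> (\<Sum>i<m. c i * b i j)"
      by (intro tendsto_intros r)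
    then show ?thesis using assms(2)[OF that] by (rule order_tendstoD(1))
  qed
  then have "\<forall>\<^sub>F l in sequentially. \<forall>j\<in>X. 0 < (\<Sum>i<m. of_rat (r i l) * b i j)"
    using assms(1) by (simp add: eventually_ball_finite)
  then obtain l where l: "\<forall>j\<in>X. 0 < (\<Sum>i<m. of_rat (r i l) * b i j)"
    using eventually_happens'[OF sequentially_bot] by blast
  \<comment> \<open>The coefficients are packed into a list because rational lists, unlike rational
    sequences, form a countable type.\<close>
  have "(\<Sum>i<m. of_rat (map (\<lambda>i. r i l) [0..<m] ! i) * b i j) = (\<Sum>i<m. of_rat (r i l) * b i j)" for j
    by (intro sum.cong) auto
  then show ?thesis using l by (intro exI[of _ "map (\<lambda>i. r i l) [0..<m]"]) simp
qed

text \<open>Negating the columns outside \<open>T\<close> reduces every pattern to the all-positive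
  one.\<close>

lemma sign_pattern_iff_positive:
  assumes "T \<subseteq> X"
  shows "T \<in> sign_patterns (row_combinations m B) X \<longleftrightarrow>
    (\<exists>c. \<forall>j\<in>X. 0 < (\<Sum>i<m. c i * ((if j \<in> T then 1 else - 1) * B (i, j))))"
proof -
  have *: "(\<Sum>i<m. c i * ((if j \<in> T then 1 else - 1) * B (i, j)))
      = (if j \<in> T then 1 else - 1) * (\<Sum>i<m. c i * B (i, j))" for c j
    by (simp add: sum_negf)
  show ?thesis
    unfolding * using assms by (fastforce simp: sign_patterns_def row_combinations_def)
qed

text \<open>A countable union over rational coefficient lists of finite intersections of strict
  linear inequalities in the entries.\<close>

lemma sets_pattern_event:
  assumes "X \<subseteq> {..<N}" "T \<subseteq> X"
  shows "pattern_event m N X T \<in> sets (matrix_space m N)"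
proof -
  have fin: "finite X" using assms finite_subset by blast
  let ?s = "\<lambda>j. if j \<in> T then 1 else - 1 :: real"
  have "pattern_event m N X T = (\<Union>q::rat list. {B \<in> space (matrix_space m N).
      \<forall>j\<in>X. 0 < (\<Sum>i<m. of_rat (q ! i) * (?s j * B (i, j)))})"
  proof (rule set_eqI)
    fix B
    have "(\<exists>c. \<forall>j\<in>X. 0 < (\<Sum>i<m. c i * (?s j * B (i, j)))) \<longleftrightarrow>
      (\<exists>q::rat list. \<forall>j\<in>X. 0 < (\<Sum>i<m. of_rat (q ! i) * (?s j * B (i, j))))"
    proof
      assume "\<exists>c. \<forall>j\<in>X. 0 < (\<Sum>i<m. c i * (?s j * B (i, j)))"
      then obtain c where c: "\<forall>j\<in>X. 0 < (\<Sum>i<m. c i * (?s j * B (i, j)))" ..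
      show "\<exists>q::rat list. \<forall>j\<in>X. 0 < (\<Sum>i<m. of_rat (q ! i) * (?s j * B (i, j)))"
        by (rule rational_combination[where c = c and b = "\<lambda>i j. ?s j * B (i, j)", OF fin]) (use c in blast)
    next
      assume "\<exists>q::rat list. \<forall>j\<in>X. 0 < (\<Sum>i<m. of_rat (q ! i) * (?s j * B (i, j)))"
      then obtain q :: "rat list" where q: "\<forall>j\<in>X. 0 < (\<Sum>i<m. of_rat (q ! i) * (?s j * B (i, j)))" ..
      then show "\<exists>c. \<forall>j\<in>X. 0 < (\<Sum>i<m. c i * (?s j * B (i, j)))"
        by (intro exI[of _ "\<lambda>i. of_rat (q ! i)"])
    qed
    then show "B \<in> pattern_event m N X T \<longleftrightarrow> B \<in> (\<Union>q::rat list. {B \<in> space (matrix_space m N).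
      \<forall>j\<in>X. 0 < (\<Sum>i<m. of_rat (q ! i) * (?s j * B (i, j)))})"
      unfolding pattern_event_def sign_pattern_iff_positive[OF assms(2)] by blast
  qed
  also have "\<dots> \<in> sets (matrix_space m N)"
  proof (intro sets.countable_UN'' countableI_type)
    fix q :: "rat list"
    have "(\<lambda>B. B (i, j)) \<in> borel_measurable (matrix_space m N)" if "i < m" "j \<in> X" for i j
      unfolding matrix_space_def using that assms by (intro measurable_component_singleton) auto
    then have "(\<lambda>B. \<Sum>i<m. of_rat (q ! i) * (?s j * B (i, j))) \<in> borel_measurable (matrix_space m N)" if "j \<in> X" for j
      using that by (intro borel_measurable_sum borel_measurable_times borel_measurable_const) auto
    then show "{B \<in> space (matrix_space m N). \<forall>j\<in>X. 0 < (\<Sum>i<m. of_rat (q ! i) * (?s j * B (i, j)))}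
        \<in> sets (matrix_space m N)"
      by (intro sets.sets_Collect_finite_All[OF _ fin] borel_measurable_less) auto
  qed
  finally show ?thesis .
qed

lemma sets_random_matrix_event:
  assumes "random_matrix M m N B" "\<Omega> \<in> sets (matrix_space m N)"
  shows "{\<omega> \<in> space M. B \<omega> \<in> \<Omega>} \<in> sets M"
proof -
  have "B -` \<Omega> \<inter> space M \<in> sets M"
    using assms unfolding random_matrix_def by (rule measurable_sets)
  moreover have "B -` \<Omega> \<inter> space M = {\<omega> \<in> space M. B \<omega> \<in> \<Omega>}" by auto
  ultimately show ?thesis by simp
qed

text \<open>Right multiplication by \<open>S\<close> negates exactly the columns in
  \<open>X - T\<close>, carrying pattern \<open>T\<close> to the all-positive pattern.\<close>

lemma pattern_event_sign_flip:
  assumes X: "X \<subseteq> {..<N}" "T \<subseteq> X" and B: "B \<in> space (matrix_space m N)"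
    and S: "S = (\<lambda>(i, j). if i = j then (if j \<in> X - T then - 1 else 1) else 0)"
  shows "mat_mult m N N B S \<in> pattern_event m N X X \<longleftrightarrow> B \<in> pattern_event m N X T"
proof -
  have entry: "mat_mult m N N B S (i, j) = (if j \<in> X - T then - 1 else 1) * B (i, j)"
    if "i < m" "j < N" for i j
  proof -
    have "mat_mult m N N B S (i, j) = (\<Sum>l<N. B (i, l) * S (l, j))"
      using that by (simp add: mat_mult_def)
    also have "\<dots> = (\<Sum>l<N. if l = j then (if j \<in> X - T then - 1 else 1) * B (i, j) else 0)"
      by (intro sum.cong) (auto simp: S)
    finally show ?thesis using that by simp
  qed
  have "mat_mult m N N B S \<in> space (matrix_space m N)"
    by (simp add: matrix_space_def space_PiM mat_mult_def)
  moreover have "(\<Sum>i<m. c i * ((if j \<in> X then 1 else - 1) * mat_mult m N N B S (i, j)))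
      = (\<Sum>i<m. c i * ((if j \<in> T then 1 else - 1) * B (i, j)))" if "j \<in> X" for c j
    using that X by (intro sum.cong) (auto simp: entry subset_iff)
  ultimately show ?thesis
    using B X unfolding pattern_event_def
    by (simp add: sign_pattern_iff_positive del: sum_negf cong: ball_cong)
qed

lemma sign_diagonal_flip:
  "sign_diagonal N (\<lambda>(i, j). if i = j then (if j \<in> Y then - 1 else 1) else 0)"
  by (simp add: sign_diagonal_def)

section \<open>Probability of losing a face and the expected face count\<close>

context prob_space
begin

lemma prob_pattern_event_eq:
  assumes B: "random_matrix M m N B" "orthant_symmetric M m N B" and X: "X \<subseteq> {..<N}" "T \<subseteq> X"
  shows "prob {\<omega> \<in> space M. B \<omega> \<in> pattern_event m N X T}
       = prob {\<omega> \<in> space M. B \<omega> \<in> pattern_event m N X X}"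
proof -
  define S :: matrix where "S = (\<lambda>(i, j). if i = j then (if j \<in> X - T then - 1 else 1) else 0)"
  have "B \<omega> \<in> space (matrix_space m N)" if "\<omega> \<in> space M" for \<omega>
    using B(1) that unfolding random_matrix_def by (rule measurable_space)
  then have "{\<omega> \<in> space M. B \<omega> \<in> pattern_event m N X T}
      = {\<omega> \<in> space M. mat_mult m N N (B \<omega>) S \<in> pattern_event m N X X}"
    using pattern_event_sign_flip[OF X _ S_def] by auto
  moreover have "sign_diagonal N S" unfolding S_def by (rule sign_diagonal_flip)
  ultimately show ?thesis
    using B(2) sets_pattern_event[OF X(1) order_refl, of m] unfolding orthant_symmetric_def by simp
qed

text \<open>All \<open>2 ^ card X\<close> patterns have the same probability \<open>p\<close>, so
  the expected number of realised patterns is \<open>2 ^ card X * p\<close>; almost surely that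
  number obeys the deterministic bounds.\<close>

lemma prob_positive_pattern_bounds:
  assumes B: "random_matrix M m N B" "orthant_symmetric M m N B"
    and gp: "AE \<omega> in M. general_position m N (B \<omega>)"
    and X: "X \<subseteq> {..<N}" "m \<le> card X"
  defines "p \<equiv> prob {\<omega> \<in> space M. B \<omega> \<in> pattern_event m N X X}"
  shows "(\<Sum>l<m. real (card X choose l)) / 2 ^ card X \<le> p"
    "p \<le> (\<Sum>l\<le>m. real (card X choose l)) / 2 ^ card X"
proof -
  have fin: "finite X" using X finite_subset by blast
  let ?E = "\<lambda>T. {\<omega> \<in> space M. B \<omega> \<in> pattern_event m N X T}"
  let ?f = "\<lambda>\<omega>. \<Sum>T\<in>Pow X. indicator (?E T) \<omega> :: real"
  have ev: "?E T \<in> events" if "T \<subseteq> X" for T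
    by (rule sets_random_matrix_event[OF B(1) sets_pattern_event[OF X(1) that]])
  have int: "integrable M ?f"
    using ev by (intro Bochner_Integration.integrable_sum) (auto simp: integrable_indicator_iff less_top[symmetric])
  have "expectation ?f = (\<Sum>T\<in>Pow X. prob (?E T))"
    using ev by (subst Bochner_Integration.integral_sum) (auto simp: integrable_indicator_iff less_top[symmetric])
  also have "\<dots> = (\<Sum>T\<in>Pow X. p)"
    unfolding p_def by (intro sum.cong refl prob_pattern_event_eq[OF B X(1)]) auto
  also have "\<dots> = 2 ^ card X * p" using fin by (simp add: card_Pow)
  finally have ex: "expectation ?f = 2 ^ card X * p" .
  have f: "?f \<omega> = real (card (sign_patterns (row_combinations m (B \<omega>)) X))" if "\<omega> \<in> space M" for \<omega>
  proof -
    have "B \<omega> \<in> space (matrix_space m N)"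
      using B(1) that unfolding random_matrix_def by (rule measurable_space)
    then have "?f \<omega> = (\<Sum>T\<in>Pow X. if T \<in> sign_patterns (row_combinations m (B \<omega>)) X then 1 else 0)"
      using that by (intro sum.cong) (auto simp: pattern_event_def indicator_def)
    also have "\<dots> = real (card (Pow X \<inter> sign_patterns (row_combinations m (B \<omega>)) X))"
      using fin by (simp add: sum.If_cases)
    also have "Pow X \<inter> sign_patterns (row_combinations m (B \<omega>)) X = sign_patterns (row_combinations m (B \<omega>)) X"
      by (auto simp: sign_patterns_def)
    finally show ?thesis .
  qed
  have "AE \<omega> in M. (\<Sum>l<m. real (card X choose l)) \<le> ?f \<omega>"
    using gp AE_space
  proof eventually_elim
    case (elim \<omega>)
    show ?case unfolding f[OF elim(2)]
      using card_sign_patterns_bounds(1)[OF elim(1) X] by (simp only: of_nat_sum[symmetric] of_nat_le_iff)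
  qed
  then have "(\<Sum>l<m. real (card X choose l)) \<le> expectation ?f"
    by (rule integral_ge_const[OF int])
  then show "(\<Sum>l<m. real (card X choose l)) / 2 ^ card X \<le> p"
    unfolding ex by (simp add: field_simps)
  have "AE \<omega> in M. ?f \<omega> \<le> (\<Sum>l\<le>m. real (card X choose l))"
    using gp AE_space
  proof eventually_elim
    case (elim \<omega>)
    show ?case unfolding f[OF elim(2)]
      using card_sign_patterns_bounds(2)[OF elim(1) X] by (simp only: of_nat_sum[symmetric] of_nat_le_iff)
  qed
  then have "expectation ?f \<le> (\<Sum>l\<le>m. real (card X choose l))"
    by (rule integral_le_const[OF int])
  then show "p \<le> (\<Sum>l\<le>m. real (card X choose l)) / 2 ^ card X"
    unfolding ex by (simp add: field_simps)
qed

text \<open>There are finitely many column sets, so their exceptional null sets unite to a null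
  set.\<close>

lemma AE_general_position:
  assumes "generic M m N B"
  shows "AE \<omega> in M. general_position m N (B \<omega>)"
proof -
  have "finite {J. J \<subseteq> {..<N} \<and> card J = m}" by simp
  then have "AE \<omega> in M. \<forall>J\<in>{J. J \<subseteq> {..<N} \<and> card J = m}.
      inj_on (mat_col m (B \<omega>)) J \<and> independent (mat_col m (B \<omega>) ` J)"
    using assms unfolding generic_def by (intro AE_finite_allI) auto
  then show ?thesis by eventually_elim (simp add: general_position_def)
qed

text \<open>By linearity the ratio is the average over all \<open>I\<close> of the survival
  probability \<open>1 - prob\<close>. The complement of each \<open>I\<close> has
  \<open>N - k\<close> elements, so the bounds are the same for every term.\<close>

lemma expected_num_faces_ratio_bounds:
  assumes kn: "k < n" "n < N" and A: "orthant_symmetric_generic_nullspace M n N A"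
  defines "r \<equiv> expected_num_faces M k n N A (orthant N) / of_nat (num_faces k (orthant N))"
  shows "ennreal (1 - (\<Sum>l\<le>N - n. real ((N - k) choose l)) / 2 ^ (N - k)) \<le> r"
    "r \<le> ennreal (1 - (\<Sum>l<N - n. real ((N - k) choose l)) / 2 ^ (N - k))"
proof -
  define m where "m = N - n"
  obtain B where B: "random_matrix M m N B" "orthant_symmetric M m N B" and gen: "generic M m N B"
    and null: "AE \<omega> in M. nullspace n N (A \<omega>) = row_space m N (B \<omega>)"
    using A unfolding orthant_symmetric_generic_nullspace_def m_def by blast
  note gp = AE_general_position[OF gen]
  define \<I> where "\<I> = {I. I \<subseteq> {..<N} \<and> card I = k}"
  have fin: "finite \<I>" by (simp add: \<I>_def)
  have cardI: "card \<I> = N choose k" by (simp add: \<I>_def n_subsets)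
  let ?X = "\<lambda>I. {..<N} - I"
  let ?E = "\<lambda>I. {\<omega> \<in> space M. B \<omega> \<in> pattern_event m N (?X I) (?X I)}"
  have ev: "?E I \<in> events" for I
    by (rule sets_random_matrix_event[OF B(1) sets_pattern_event]) auto
  \<comment> \<open>The face count is replaced almost everywhere by a sum of indicators of
    measurable events, on which the integral is additive.\<close>
  have "AE \<omega> in M. of_nat (num_faces k (mat_vec n N (A \<omega>) ` orthant N))
      = (\<Sum>I\<in>\<I>. indicator (space M - ?E I) \<omega> :: ennreal)"
    using gp null AE_space
  proof eventually_elim
    case (elim \<omega>)
    have "B \<omega> \<in> space (matrix_space m N)"
      using B(1) elim(3) unfolding random_matrix_def by (rule measurable_space)
    then have "(\<Sum>I\<in>\<I>. indicator (space M - ?E I) \<omega> :: ennreal)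
        = (\<Sum>I\<in>\<I>. if ?X I \<notin> sign_patterns (row_combinations m (B \<omega>)) (?X I) then 1 else 0)"
      using elim(3) by (intro sum.cong) (auto simp: pattern_event_def indicator_def)
    also have "\<dots> = of_nat (card {I \<in> \<I>. ?X I \<notin> sign_patterns (row_combinations m (B \<omega>)) (?X I)})"
      using fin by (simp add: sum.If_cases Int_def)
    also have "{I \<in> \<I>. ?X I \<notin> sign_patterns (row_combinations m (B \<omega>)) (?X I)}
        = {I. I \<subseteq> {..<N} \<and> card I = k \<and> ?X I \<notin> sign_patterns (row_combinations m (B \<omega>)) (?X I)}"
      by (auto simp: \<I>_def)
    also have "card \<dots> = num_faces k (mat_vec n N (A \<omega>) ` orthant N)"
      using num_faces_image_orthant[OF kn, of "B \<omega>" "A \<omega>"] elim unfolding m_def by simp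
    finally show ?case by simp
  qed
  then have "expected_num_faces M k n N A (orthant N)
      = (\<integral>\<^sup>+ \<omega>. (\<Sum>I\<in>\<I>. indicator (space M - ?E I) \<omega>) \<partial>M)"
    unfolding expected_num_faces_def by (rule nn_integral_cong_AE)
  also have "\<dots> = (\<Sum>I\<in>\<I>. emeasure M (space M - ?E I))"
    using ev by (subst nn_integral_sum) auto
  also have "\<dots> = (\<Sum>I\<in>\<I>. ennreal (1 - prob (?E I)))"
    using ev by (intro sum.cong refl) (simp only: emeasure_eq_measure prob_compl)
  also have "\<dots> = ennreal (\<Sum>I\<in>\<I>. 1 - prob (?E I))"
    by (intro sum_ennreal) simp
  finally have ex: "expected_num_faces M k n N A (orthant N) = ennreal (\<Sum>I\<in>\<I>. 1 - prob (?E I))" .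
  have pos: "0 < real (N choose k)" using kn by (simp add: zero_less_binomial_iff)
  have "ennreal (real (N choose k)) = of_nat (N choose k)" by (rule ennreal_of_nat_eq_real_of_nat[symmetric])
  then have r: "r = ennreal ((\<Sum>I\<in>\<I>. 1 - prob (?E I)) / real (N choose k))"
    unfolding r_def ex num_faces_orthant
    using divide_ennreal[of "\<Sum>I\<in>\<I>. 1 - prob (?E I)" "real (N choose k)"] pos
    by (simp add: sum_nonneg)
  have cardX: "card (?X I) = N - k" if "I \<in> \<I>" for I
    using that finite_subset[of I "{..<N}"] by (simp add: \<I>_def card_Diff_subset)
  have bounds: "(\<Sum>l<m. real ((N - k) choose l)) / 2 ^ (N - k) \<le> prob (?E I)"
    "prob (?E I) \<le> (\<Sum>l\<le>m. real ((N - k) choose l)) / 2 ^ (N - k)" if "I \<in> \<I>" for I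
    using prob_positive_pattern_bounds[OF B gp, of "?X I"] cardX[OF that] kn by (auto simp: m_def)
  have "real (N choose k) * (1 - (\<Sum>l\<le>m. real ((N - k) choose l)) / 2 ^ (N - k)) \<le> (\<Sum>I\<in>\<I>. 1 - prob (?E I))"
    using bounds(2) by (subst cardI[symmetric], intro sum_bounded_below) simp
  then show "ennreal (1 - (\<Sum>l\<le>N - n. real ((N - k) choose l)) / 2 ^ (N - k)) \<le> r"
    unfolding r m_def using pos by (intro ennreal_leI) (simp add: pos_le_divide_eq mult.commute)
  have "(\<Sum>I\<in>\<I>. 1 - prob (?E I)) \<le> real (N choose k) * (1 - (\<Sum>l<m. real ((N - k) choose l)) / 2 ^ (N - k))"
    using bounds(1) by (subst cardI[symmetric], intro sum_bounded_above) simp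
  then show "r \<le> ennreal (1 - (\<Sum>l<N - n. real ((N - k) choose l)) / 2 ^ (N - k))"
    unfolding r m_def using pos by (intro ennreal_leI) (simp add: pos_divide_le_eq mult.commute)
qed

end

section \<open>The limit on either side of the threshold\<close>

theorem theorem1p6:
  fixes \<rho> \<delta> :: real
    and k N :: "nat \<Rightarrow> nat"
    and M :: "nat \<Rightarrow> 'a measure"
    and A :: "nat \<Rightarrow> 'a \<Rightarrow> matrix"
  assumes "0 < \<rho>" "\<rho> < 1" "0 < \<delta>" "\<delta> < 1"
    and "\<And>n. n \<ge> 1 \<Longrightarrow> k n < n \<and> n < N n"
    and "(\<lambda>n. real (k n) / real n) \<longlonglongrightarrow> \<rho>"
    and "(\<lambda>n. real n / real (N n)) \<longlonglongrightarrow> \<delta>"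
    and "\<And>n. n \<ge> 1 \<Longrightarrow> prob_space (M n)"
    and "\<And>n. n \<ge> 1 \<Longrightarrow> random_matrix (M n) n (N n) (A n)"
    and "\<And>n. n \<ge> 1 \<Longrightarrow> orthant_symmetric_generic_nullspace (M n) n (N n) (A n)"
  shows "(\<rho> < rho_W_orthant \<delta> \<longrightarrow>
           (\<lambda>n. expected_num_faces (M n) (k n) n (N n) (A n) (orthant (N n))
                  / of_nat (num_faces (k n) (orthant (N n)))) \<longlonglongrightarrow> 1) \<and>
         (\<rho> > rho_W_orthant \<delta> \<longrightarrow>
           (\<lambda>n. expected_num_faces (M n) (k n) n (N n) (A n) (orthant (N n))
                  / of_nat (num_faces (k n) (orthant (N n)))) \<longlonglongrightarrow> 0)"
proof -
  let ?r = "\<lambda>n. expected_num_faces (M n) (k n) n (N n) (A n) (orthant (N n))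
                  / of_nat (num_faces (k n) (orthant (N n)))"
  let ?K = "\<lambda>n. N n - k n" and ?m = "\<lambda>n. N n - n"
  let ?e = "\<lambda>n. real (?K n) / (4 * (real (?K n) / 2 - real (?m n))\<^sup>2)"
  note kN = assms(5)
  note seq = assms(2-7)
  have ratio: "(\<lambda>n. real (?m n) / real (?K n)) \<longlonglongrightarrow> (1 - \<delta>) / (1 - \<rho> * \<delta>)"
    by (rule codim_ratio_tendsto[OF seq])
  have e0: "?e \<longlonglongrightarrow> 0" if "(1 - \<delta>) / (1 - \<rho> * \<delta>) \<noteq> 1/2"
    by (rule deviation_bound_tendsto_0[OF ratio that codim_filterlim[OF seq]])
  have K: "0 < real (?K n)" "?m n \<le> ?K n" if "n \<ge> 1" for n using kN[OF that] by auto
  have lower: "ennreal (1 - (\<Sum>l\<le>?m n. real (?K n choose l)) / 2 ^ ?K n) \<le> ?r n"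
    and upper: "?r n \<le> ennreal (1 - (\<Sum>l<?m n. real (?K n choose l)) / 2 ^ ?K n)" if "n \<ge> 1" for n
    using prob_space.expected_num_faces_ratio_bounds[OF assms(8)[OF that] _ _ assms(10)[OF that]] kN[OF that]
    by auto
  have "?r \<longlonglongrightarrow> 1" if "\<rho> < rho_W_orthant \<delta>"
  proof -
    \<comment> \<open>As \<rho> is positive, lying below the maximum with 0 means lying below
      \<open>2 - 1 / \<delta>\<close>.\<close>
    have lt: "(1 - \<delta>) / (1 - \<rho> * \<delta>) < 1/2"
      using that assms(1) codim_ratio_less_half_iff(1)[OF seq] by (simp add: rho_W_orthant_def)
    have "\<forall>\<^sub>F n in sequentially. real (?m n) / real (?K n) < 1/2"
      using order_tendstoD(2)[OF ratio lt] .
    \<comment> \<open>The lower-tail estimate bounds the loss probability by \<open>?e n\<close>.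
      Should \<open>1 - ?e n\<close> be negative, \<open>ennreal\<close> truncates it to 0 and the
      bound still holds.\<close>
    then have "\<forall>\<^sub>F n in sequentially. ennreal (1 - ?e n) \<le> ?r n"
      using eventually_ge_at_top[of 1]
    proof eventually_elim
      case (elim n)
      then have "real (?m n) < real (?K n) / 2" using K(1)[OF elim(2)] by (simp add: pos_divide_less_eq)
      then have "ennreal (1 - ?e n) \<le> ennreal (1 - (\<Sum>l\<le>?m n. real (?K n choose l)) / 2 ^ ?K n)"
        by (intro ennreal_leI diff_left_mono binomial_lower_tail)
      then show ?case using lower[OF elim(2)] by (rule order_trans)
    qed
    moreover have "\<forall>\<^sub>F n in sequentially. ?r n \<le> 1"
      using eventually_ge_at_top[of 1]
    proof eventually_elim
      case (elim n)
      have "ennreal (1 - (\<Sum>l<?m n. real (?K n choose l)) / 2 ^ ?K n) \<le> ennreal 1"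
        by (intro ennreal_leI) (simp add: sum_nonneg)
      from order_trans[OF upper[OF elim] this] show ?case by (simp only: ennreal_1)
    qed
    moreover have "(\<lambda>n. ennreal (1 - ?e n)) \<longlonglongrightarrow> ennreal (1 - 0)"
      by (intro tendsto_ennrealI tendsto_diff tendsto_const e0 less_imp_neq[OF lt])
    ultimately show ?thesis
      by (intro tendsto_sandwich[of "\<lambda>n. ennreal (1 - ?e n)" ?r sequentially "\<lambda>_. 1"]) auto
  qed
  moreover have "?r \<longlonglongrightarrow> 0" if "\<rho> > rho_W_orthant \<delta>"
  proof -
    have gt: "(1 - \<delta>) / (1 - \<rho> * \<delta>) > 1/2"
      using that codim_ratio_less_half_iff(2)[OF seq] by (simp add: rho_W_orthant_def)
    have "\<forall>\<^sub>F n in sequentially. real (?m n) / real (?K n) > 1/2"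
      using order_tendstoD(1)[OF ratio gt] .
    \<comment> \<open>Now \<open>?m n\<close> exceeds half of \<open>?K n\<close>, so the survival
      bound is an upper binomial tail, controlled by the same \<open>?e n\<close>.\<close>
    then have "\<forall>\<^sub>F n in sequentially. ?r n \<le> ennreal (?e n)"
      using eventually_ge_at_top[of 1]
    proof eventually_elim
      case (elim n)
      then have "real (?K n) / 2 < real (?m n)" using K(1)[OF elim(2)] by (simp add: pos_less_divide_eq)
      then have "ennreal (1 - (\<Sum>l<?m n. real (?K n choose l)) / 2 ^ ?K n) \<le> ennreal (?e n)"
        using K(2)[OF elim(2)] by (intro ennreal_leI binomial_upper_tail)
      then show ?case using upper[OF elim(2)] by (rule order_trans[rotated])
    qed
    moreover have "(\<lambda>n. ennreal (?e n)) \<longlonglongrightarrow> ennreal 0"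
      by (intro tendsto_ennrealI e0 less_imp_neq[OF gt, symmetric])
    ultimately show ?thesis
      by (intro tendsto_sandwich[of "\<lambda>_. 0" ?r sequentially "\<lambda>n. ennreal (?e n)"]) auto
  qed
  ultimately show ?thesis by blast
qed

end
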